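(* Let $p$ be an odd prime. Bousfield's category $\mathcal{A}(p)$ is isomorphic to the category of discrete $A$-modules: every discrete $A$-module, regarded as an $R$-module via the inclusion $R\subset A$, is a Bousfield module, and every Bousfield module admits a unique $A$-module structure extending its $R$-module structure which makes it a discrete $A$-module.
   Context: $\mathbb{Z}_{(p)}$ denotes the $p$-local integers and $\mathbb{Z}_{(p)}^\times$ its group of units. $A=K^0_{(p)}(K_{(p)})$ is the ring of degree zero stable operations in $p$-local complex $K$-theory. Fix $q$ primitive modulo $p^2$, let $\Psi^q\in A$ be the Adams operation, $q_i=q^{(-1)^i\lfloor i/2\rfloor}$, $\Theta_n(X)=\prod_{i=1}^n(X-q_i)$, $\Phi_n=\Theta_n(\Psi^q)$. Every element of $A$ is uniquely a convergent sum $\sum_{n\ge0}a_n\Phi_n$, $a_n\in\mathbb{Z}_{(p)}$. Let $A_m=\{\sum_{n\ge m}a_n\Phi_n\}$. An $A$-module $M$ is discrete if for each $x\in M$ there is $n$ with $A_nx=0$ (equivalently, the action $A\times M\to M$ is continuous for the $A_m$-filtration topology on $A$ and the discrete topology on $M$); the category of discrete $A$-modules is the full subcategory of $A$-modules on these objects. Let $R=\mathbb{Z}_{(p)}[\mathbb{Z}_{(p)}^\times]$ be the group ring, writing $\Psi^j$ for $j\in\mathbb{Z}_{(p)}^\times$; sending $\Psi^j$ to the Adams operation $\Psi^j\in A$ gives an inclusion $R\subset A$. Bousfield's category $\mathcal{A}(p)$ is the full subcategory of $R$-modules $M$ (Bousfield modules) such that for each $x\in M$: (a) $Rx$ is finitely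 generated over $\mathbb{Z}_{(p)}$; (b) for each $j\in\mathbb{Z}_{(p)}^\times$, $\Psi^j$ acts on $Rx\otimes\mathbb{Q}$ by a diagonalisable matrix whose eigenvalues are integer powers of $j$; (c) for each $m\ge1$ the action of $\mathbb{Z}_{(p)}^\times$ on $Rx/p^mRx$ factors through $\mathbb{Z}_{(p)}^\times\to(\mathbb{Z}/p^k\mathbb{Z})^\times$ for sufficiently large $k$. *)

theory Defs
  imports "HOL-Number_Theory.Number_Theory"
begin

definition zp :: "nat \<Rightarrow> rat set" where
  "zp p = {r. coprime (snd (quotient_of r)) (int p)}"

definition zp_units :: "nat \<Rightarrow> rat set" where
  "zp_units p = {r \<in> zp p. r \<noteq> 0 \<and> inverse r \<in> zp p}"

definition primitive_mod :: "int \<Rightarrow> int \<Rightarrow> bool" where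
  "primitive_mod m q \<longleftrightarrow> coprime q m \<and>
     (\<forall>k::nat. 0 < k \<and> k < totient (nat m) \<longrightarrow> \<not> [q ^ k = 1] (mod m))"

definition qexp :: "nat \<Rightarrow> int" where
  "qexp i = (-1) ^ i * int (i div 2)"

definition qi :: "int \<Rightarrow> nat \<Rightarrow> rat" where
  "qi q i = (of_int q :: rat) powi qexp i"

definition Theta :: "int \<Rightarrow> nat \<Rightarrow> rat \<Rightarrow> rat" where
  "Theta q n X = (\<Prod>i\<in>{1..n}. X - qi q i)"

(* Model of A: an operation is recorded by the scalars by which it acts on the
   weight-k pieces (k \<in> Z), where Psi^j acts by j^k.  Phi_n = Theta_n(Psi^q)
   acts on weight k by Theta_n(q^k).  The sum below is the convergent sum
   \<Sum>_n a_n Phi_n evaluated at weight k: all terms with n > 2|k|+1 vanish. *)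
definition Phi :: "int \<Rightarrow> nat \<Rightarrow> int \<Rightarrow> rat" where
  "Phi q n = (\<lambda>k. Theta q n ((of_int q :: rat) powi k))"

definition A_elem :: "int \<Rightarrow> (nat \<Rightarrow> rat) \<Rightarrow> int \<Rightarrow> rat" where
  "A_elem q a = (\<lambda>k. \<Sum>n\<le>nat (2 * \<bar>k\<bar> + 1). a n * Phi q n k)"

definition Aset :: "nat \<Rightarrow> int \<Rightarrow> (int \<Rightarrow> rat) set" where
  "Aset p q = {A_elem q a | a. \<forall>n. a n \<in> zp p}"

definition Afilt :: "nat \<Rightarrow> int \<Rightarrow> nat \<Rightarrow> (int \<Rightarrow> rat) set" where
  "Afilt p q m = {A_elem q a | a. (\<forall>n. a n \<in> zp p) \<and> (\<forall>n<m. a n = 0)}"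

definition adams :: "rat \<Rightarrow> int \<Rightarrow> rat" where
  "adams j = (\<lambda>k. j powi k)"

definition const_op :: "rat \<Rightarrow> int \<Rightarrow> rat" where
  "const_op c = (\<lambda>k. c)"

definition A_module :: "nat \<Rightarrow> int \<Rightarrow> ((int \<Rightarrow> rat) \<Rightarrow> 'm::ab_group_add \<Rightarrow> 'm) \<Rightarrow> bool" where
  "A_module p q act \<longleftrightarrow>
     (\<forall>f\<in>Aset p q. \<forall>x y. act f (x + y) = act f x + act f y) \<and>
     (\<forall>f\<in>Aset p q. \<forall>g\<in>Aset p q. \<forall>x. act (\<lambda>k. f k + g k) x = act f x + act g x) \<and>
     (\<forall>f\<in>Aset p q. \<forall>g\<in>Aset p q. \<forall>x. act (\<lambda>k. f k * g k) x = act f (act g x)) \<and>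
     (\<forall>x. act (\<lambda>k. 1) x = x)"

definition discrete_A_module :: "nat \<Rightarrow> int \<Rightarrow> ((int \<Rightarrow> rat) \<Rightarrow> 'm::ab_group_add \<Rightarrow> 'm) \<Rightarrow> bool" where
  "discrete_A_module p q act \<longleftrightarrow> A_module p q act \<and>
     (\<forall>x. \<exists>n. \<forall>f\<in>Afilt p q n. act f x = 0)"

definition zp_module :: "nat \<Rightarrow> (rat \<Rightarrow> 'm::ab_group_add \<Rightarrow> 'm) \<Rightarrow> bool" where
  "zp_module p sc \<longleftrightarrow>
     (\<forall>c\<in>zp p. \<forall>x y. sc c (x + y) = sc c x + sc c y) \<and>
     (\<forall>c\<in>zp p. \<forall>d\<in>zp p. \<forall>x. sc (c + d) x = sc c x + sc d x) \<and>
     (\<forall>c\<in>zp p. \<forall>d\<in>zp p. \<forall>x. sc (c * d) x = sc c (sc d x)) \<and>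
     (\<forall>x. sc 1 x = x)"

definition R_module :: "nat \<Rightarrow> (rat \<Rightarrow> 'm::ab_group_add \<Rightarrow> 'm) \<Rightarrow> (rat \<Rightarrow> 'm \<Rightarrow> 'm) \<Rightarrow> bool" where
  "R_module p sc psi \<longleftrightarrow> zp_module p sc \<and>
     (\<forall>j\<in>zp_units p. \<forall>x y. psi j (x + y) = psi j x + psi j y) \<and>
     (\<forall>j\<in>zp_units p. \<forall>c\<in>zp p. \<forall>x. psi j (sc c x) = sc c (psi j x)) \<and>
     (\<forall>x. psi 1 x = x) \<and>
     (\<forall>j\<in>zp_units p. \<forall>j'\<in>zp_units p. \<forall>x. psi (j * j') x = psi j (psi j' x))"

definition zspan :: "nat \<Rightarrow> (rat \<Rightarrow> 'm::ab_group_add \<Rightarrow> 'm) \<Rightarrow> 'm set \<Rightarrow> 'm set" where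
  "zspan p sc S = {\<Sum>s\<in>F. sc (c s) s | F c. finite F \<and> F \<subseteq> S \<and> (\<forall>s\<in>F. c s \<in> zp p)}"

definition Rsub :: "nat \<Rightarrow> (rat \<Rightarrow> 'm::ab_group_add \<Rightarrow> 'm) \<Rightarrow> (rat \<Rightarrow> 'm \<Rightarrow> 'm) \<Rightarrow> 'm \<Rightarrow> 'm set" where
  "Rsub p sc psi x = zspan p sc {psi j x | j. j \<in> zp_units p}"

(* z \<otimes> 1 = 0 in M \<otimes> Q *)
definition is_torsion :: "(rat \<Rightarrow> 'm::ab_group_add \<Rightarrow> 'm) \<Rightarrow> 'm \<Rightarrow> bool" where
  "is_torsion sc z \<longleftrightarrow> (\<exists>n::int. n \<noteq> 0 \<and> sc (of_int n) z = 0)"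

definition bousfield_module :: "nat \<Rightarrow> (rat \<Rightarrow> 'm::ab_group_add \<Rightarrow> 'm) \<Rightarrow> (rat \<Rightarrow> 'm \<Rightarrow> 'm) \<Rightarrow> bool" where
  "bousfield_module p sc psi \<longleftrightarrow> R_module p sc psi \<and>
     (\<forall>x. \<comment> \<open>(a) Rx finitely generated over Z_(p)\<close>
          (\<exists>S. finite S \<and> zspan p sc S = Rsub p sc psi x) \<and>
          \<comment> \<open>(b) Rx \<otimes> Q is spanned by eigenvectors of Psi^j with eigenvalues powers of j\<close>
          (\<forall>j\<in>zp_units p. \<forall>y\<in>Rsub p sc psi x. \<exists>d::int. d \<noteq> 0 \<and>
              (\<exists>(F::nat set) ys ks. finite F \<and>
                 (\<forall>i\<in>F. ys i \<in> Rsub p sc psi x \<and>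
                     is_torsion sc (psi j (ys i) - sc (j powi ks i) (ys i))) \<and>
                 is_torsion sc (sc (of_int d) y - (\<Sum>i\<in>F. ys i)))) \<and>
          \<comment> \<open>(c) action on Rx / p^m Rx factors through (Z/p^k)^x\<close>
          (\<forall>m::nat. m \<ge> 1 \<longrightarrow> (\<exists>k::nat. \<forall>j\<in>zp_units p. \<forall>j'\<in>zp_units p.
              (j - j') / of_nat (p ^ k) \<in> zp p \<longrightarrow>
              (\<forall>y\<in>Rsub p sc psi x. psi j y - psi j' y \<in>
                  {sc (of_nat (p ^ m)) z | z. z \<in> Rsub p sc psi x}))))"

definition extends_R :: "nat \<Rightarrow> (rat \<Rightarrow> 'm::ab_group_add \<Rightarrow> 'm) \<Rightarrow> (rat \<Rightarrow> 'm \<Rightarrow> 'm) \<Rightarrow> ((int \<Rightarrow> rat) \<Rightarrow> 'm \<Rightarrow> 'm) \<Rightarrow> bool" where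
  "extends_R p sc psi act \<longleftrightarrow>
     (\<forall>c\<in>zp p. act (const_op c) = sc c) \<and> (\<forall>j\<in>zp_units p. act (adams j) = psi j)"

definition R_hom :: "nat \<Rightarrow> (rat \<Rightarrow> 'm::ab_group_add \<Rightarrow> 'm) \<Rightarrow> (rat \<Rightarrow> 'm \<Rightarrow> 'm) \<Rightarrow>
    (rat \<Rightarrow> 'n::ab_group_add \<Rightarrow> 'n) \<Rightarrow> (rat \<Rightarrow> 'n \<Rightarrow> 'n) \<Rightarrow> ('m \<Rightarrow> 'n) \<Rightarrow> bool" where
  "R_hom p sc psi sc' psi' h \<longleftrightarrow>
     (\<forall>x y. h (x + y) = h x + h y) \<and>
     (\<forall>c\<in>zp p. \<forall>x. h (sc c x) = sc' c (h x)) \<and>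
     (\<forall>j\<in>zp_units p. \<forall>x. h (psi j x) = psi' j (h x))"

definition A_hom :: "nat \<Rightarrow> int \<Rightarrow> ((int \<Rightarrow> rat) \<Rightarrow> 'm::ab_group_add \<Rightarrow> 'm) \<Rightarrow>
    ((int \<Rightarrow> rat) \<Rightarrow> 'n::ab_group_add \<Rightarrow> 'n) \<Rightarrow> ('m \<Rightarrow> 'n) \<Rightarrow> bool" where
  "A_hom p q act act' h \<longleftrightarrow>
     (\<forall>x y. h (x + y) = h x + h y) \<and> (\<forall>f\<in>Aset p q. \<forall>x. h (act f x) = act' f (h x))"

end

theory Submission
  imports Defs "HOL-Computational_Algebra.Polynomial"
begin

text \<open>
  Everything is reduced to polynomials in \<open>\<Psi>\<^sup>q\<close>.  A function of the weight lies in \<open>A\<close> iff on any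
  finite set of weights it agrees with a \<open>p\<close>-local polynomial in \<open>q\<^sup>k\<close>; since \<open>q\<close> generates the
  units modulo every \<open>p\<^sup>N\<close>, this applies to all Adams operations, and an element killed by \<open>A\<^sub>n\<close> only
  sees the polynomial attached to the first \<open>n\<close> weights.  With Lagrange interpolation, whose
  denominators are bounded for fixed \<open>n\<close>, this turns a discrete module into a Bousfield module.

  Conversely, let \<open>x\<close> lie in a Bousfield module.  By diagonalisability some \<open>\<Theta>\<^sub>n(\<Psi>\<^sup>q) x\<close> is torsion.
  The torsion of \<open>R x\<close> has bounded exponent \<open>p\<^sup>t\<close>, and on it \<open>(\<Psi>\<^sup>q)\<^sup>s = 1\<close> for some \<open>s = p\<^sup>k (p - 1)\<close>.
  A product of \<open>X - q\<^sup>e\<close> over \<open>s\<close> consecutive exponents \<open>e\<close> is congruent to \<open>X\<^sup>s - 1\<close> modulo \<open>p\<close>,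
  so \<open>t\<close> such products annihilate the torsion, and \<open>\<Theta>\<^sub>n(\<Psi>\<^sup>q) x = 0\<close> for large \<open>n\<close>.  Hence \<open>A\<close> acts on \<open>x\<close>
  through polynomials in \<open>\<Psi>\<^sup>q\<close>.  That \<open>\<Psi>\<^sup>j \<in> A\<close> acts as the given \<open>\<Psi>\<^sup>j\<close> holds modulo \<open>p\<^sup>m R x\<close> for every
  \<open>m\<close>, which suffices because \<open>R x\<close> is \<open>p\<close>-adically separated.
\<close>

section \<open>p-local rationals and polynomials\<close>

locale p_local =
  fixes p :: nat
  assumes prime_p: "prime p"
begin

section \<open>The local ring \<open>zp p\<close> and its units\<close>

lemma p_pos: "p > 0" and p_gt_1: "p > 1"
  using prime_p prime_gt_0_nat prime_gt_1_nat by auto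

lemma coprime_p_iff: "coprime c (int p) \<longleftrightarrow> \<not> int p dvd c"
  using prime_p prime_imp_coprime[of "int p" c] p_gt_1
  by (auto simp: coprime_commute dest: coprime_common_divisor[of _ _ "int p"])

lemma zp_of_int_div: "coprime b (int p) \<Longrightarrow> of_int a / of_int b \<in> zp p"
proof -
  assume cop: "coprime b (int p)"
  have b0: "b \<noteq> 0" using cop p_gt_1 by (cases "b = 0") auto
  obtain n d where nd: "quotient_of (of_int a / of_int b) = (n, d)" by fastforce
  have dpos: "d > 0" and "coprime n d" using nd quotient_of_denom_pos quotient_of_coprime by auto
  have "(of_int a :: rat) / of_int b = of_int n / of_int d" using nd by (rule quotient_of_div)
  hence "(of_int (a * d) :: rat) = of_int (n * b)" using b0 dpos by (simp add: field_simps)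
  hence "a * d = n * b" by (simp only: of_int_eq_iff)
  hence "d dvd n * b" by (metis dvd_triv_right)
  hence "d dvd b" using \<open>coprime n d\<close> by (simp add: coprime_commute coprime_dvd_mult_right_iff)
  hence "coprime d (int p)" using cop coprime_divisors[of d b "int p" "int p"] by auto
  thus ?thesis using nd by (simp add: zp_def)
qed

lemma zpE:
  assumes "r \<in> zp p"
  obtains a b where "coprime b (int p)" "b \<noteq> 0" "r = of_int a / of_int b"
proof -
  obtain n d where nd: "quotient_of r = (n, d)" by fastforce
  show ?thesis
    using that[of d n] nd assms quotient_of_denom_pos[OF nd] quotient_of_div[OF nd]
    by (auto simp: zp_def)
qed

lemma zp_of_int [simp]: "of_int a \<in> zp p"
  using zp_of_int_div[of 1 a] by simp

lemma zp_0 [simp]: "0 \<in> zp p" and zp_1 [simp]: "1 \<in> zp p"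
  using zp_of_int[of 0] zp_of_int[of 1] by auto

lemma zp_of_nat [simp]: "of_nat a \<in> zp p"
  using zp_of_int[of "int a"] by simp

lemma zp_add [simp]: "r \<in> zp p \<Longrightarrow> s \<in> zp p \<Longrightarrow> r + s \<in> zp p"
proof -
  assume "r \<in> zp p" "s \<in> zp p"
  then obtain a b c d where *: "coprime b (int p)" "b \<noteq> 0" "r = of_int a / of_int b"
      "coprime d (int p)" "d \<noteq> 0" "s = of_int c / of_int d" by (metis zpE)
  have "r + s = of_int (a * d + c * b) / of_int (b * d)" using * by (simp add: field_simps)
  thus ?thesis using zp_of_int_div[of "b * d"] * by (simp only: coprime_mult_left_iff)
qed

lemma zp_mult [simp]: "r \<in> zp p \<Longrightarrow> s \<in> zp p \<Longrightarrow> r * s \<in> zp p"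
proof -
  assume "r \<in> zp p" "s \<in> zp p"
  then obtain a b c d where *: "coprime b (int p)" "b \<noteq> 0" "r = of_int a / of_int b"
      "coprime d (int p)" "d \<noteq> 0" "s = of_int c / of_int d" by (metis zpE)
  have "r * s = of_int (a * c) / of_int (b * d)" using * by (simp add: field_simps)
  thus ?thesis using zp_of_int_div[of "b * d"] * by (simp only: coprime_mult_left_iff)
qed

lemma zp_uminus [simp]: "- r \<in> zp p \<longleftrightarrow> r \<in> zp p"
  using zp_mult[of "-1" r] zp_mult[of "-1" "-r"] zp_of_int[of "-1"] by auto

lemma zp_diff [simp]: "r \<in> zp p \<Longrightarrow> s \<in> zp p \<Longrightarrow> r - s \<in> zp p"
  using zp_add[of r "-s"] by simp

lemma zp_power [simp]: "r \<in> zp p \<Longrightarrow> r ^ n \<in> zp p"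
  by (induction n) auto

lemma zp_sum: "(\<And>i. i \<in> F \<Longrightarrow> f i \<in> zp p) \<Longrightarrow> sum f F \<in> zp p"
  by (induction F rule: infinite_finite_induct) auto

lemma p_power_neq_0 [simp]: "(of_nat p :: rat) ^ n \<noteq> 0"
  using p_pos by simp

lemma inverse_p_notin_zp: "1 / of_nat p \<notin> zp p"
proof
  assume "1 / of_nat p \<in> zp p"
  then obtain a b where *: "coprime b (int p)" "b \<noteq> 0" "1 / of_nat p = (of_int a / of_int b :: rat)"
    by (metis zpE)
  hence "(of_int b :: rat) = of_int (a * int p)" using p_pos by (simp add: field_simps)
  hence "b = a * int p" by (simp only: of_int_eq_iff)
  with * show False using p_gt_1 by simp
qed

text \<open>Write the numerator of \<open>r\<close> as \<open>p^v * c\<close> with \<open>c\<close>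
  prime to \<open>p\<close>; then \<open>p^v / r\<close> has denominator \<open>c\<close>. This
  clears denominators by powers of \<open>p\<close> alone in all later interpolation and torsion
  arguments.\<close>

lemma p_power_over_in_zp: "r \<noteq> 0 \<Longrightarrow> \<exists>n. of_nat p ^ n / r \<in> zp p"
proof -
  assume r0: "r \<noteq> 0"
  obtain a b where ab: "quotient_of r = (a, b)" by fastforce
  have r: "r = of_int a / of_int b" and b: "b > 0"
    using ab quotient_of_div quotient_of_denom_pos by auto
  have a0: "a \<noteq> 0" using r r0 by auto
  have np: "\<not> is_unit (int p)" using p_gt_1 by simp
  obtain c where c: "a = int p ^ multiplicity (int p) a * c" "\<not> int p dvd c"
    using multiplicity_decompose'[OF a0 np] by metis
  have "coprime c (int p)"
    using c(2) by (simp add: coprime_p_iff)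
  have "of_nat p ^ multiplicity (int p) a / r = of_int b / of_int c"
    unfolding r using a0 b by (subst c(1)) (auto simp: field_simps)
  thus ?thesis using zp_of_int_div[OF \<open>coprime c (int p)\<close>, of b] by metis
qed

text \<open>Locality of \<open>zp p\<close>: the maximal ideal is generated by \<open>p\<close>,
  since a fraction becomes a non-unit only when \<open>p\<close> divides its numerator. Congruence
  modulo \<open>p^n\<close> is written throughout as \<open>(x - y) / p^n\<close> being
  p-local.\<close>

lemma zp_inverse: 
  assumes "r \<in> zp p" "r / of_nat p \<notin> zp p"
  shows "r \<noteq> 0" "inverse r \<in> zp p"
proof -
  show "r \<noteq> 0" using assms by auto
  obtain a b where *: "coprime b (int p)" "b \<noteq> 0" "r = of_int a / of_int b" by (metis zpE assms(1))
  have "\<not> int p dvd a"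
  proof
    assume "int p dvd a"
    then obtain c where "a = int p * c" by auto
    hence "r / of_nat p = of_int c / of_int b" using * p_pos by (simp add: field_simps)
    thus False using zp_of_int_div[OF *(1), of c] assms(2) by simp
  qed
  hence "coprime a (int p)" by (simp add: coprime_p_iff)
  thus "inverse r \<in> zp p" using zp_of_int_div[of a b] * by simp
qed

lemma zp_units_iff: "r \<in> zp_units p \<longleftrightarrow> r \<in> zp p \<and> r / of_nat p \<notin> zp p"
proof
  assume r: "r \<in> zp_units p"
  have False if "r / of_nat p \<in> zp p"
  proof -
    have "inverse r * (r / of_nat p) \<in> zp p" using that r by (intro zp_mult) (auto simp: zp_units_def)
    moreover have "inverse r * (r / of_nat p) = 1 / of_nat p"
      using r by (simp add: zp_units_def)
    ultimately show False using inverse_p_notin_zp by metis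
  qed
  thus "r \<in> zp p \<and> r / of_nat p \<notin> zp p" using r by (auto simp: zp_units_def)
qed (auto simp: zp_units_def zp_inverse)

text \<open>If \<open>r\<close> were nonzero, some \<open>p^n / r\<close> would be p-local, and its
  product with \<open>r / p^(n+1)\<close> would make \<open>1 / p\<close> p-local.\<close>

lemma zp_infinitely_divisible:
  assumes "\<And>n. r / of_nat p ^ n \<in> zp p"
  shows "r = 0"
proof (rule ccontr)
  assume "r \<noteq> 0"
  then obtain n where n: "of_nat p ^ n / r \<in> zp p" using p_power_over_in_zp by blast
  have "(of_nat p ^ n / r) * (r / of_nat p ^ Suc n) \<in> zp p" using n assms by (intro zp_mult)
  moreover have "(of_nat p ^ n / r) * (r / of_nat p ^ Suc n) = 1 / of_nat p"
    using \<open>r \<noteq> 0\<close> p_pos by (simp add: field_simps)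
  ultimately show False using inverse_p_notin_zp by simp
qed

lemma zp_divide_power_mono:
  assumes "r / of_nat p ^ n \<in> zp p" "m \<le> n"
  shows "r / of_nat p ^ m \<in> zp p"
proof -
  have "(of_nat p :: rat) ^ n = of_nat p ^ (n - m) * of_nat p ^ m"
    using assms(2) by (simp flip: power_add)
  hence "r / of_nat p ^ m = of_nat (p ^ (n - m)) * (r / of_nat p ^ n)"
    using p_pos by simp
  thus ?thesis using assms by (metis zp_mult zp_of_nat)
qed

lemma zp_units_1 [simp]: "1 \<in> zp_units p"
  by (simp add: zp_units_def)

lemma zp_units_mult [simp]: "r \<in> zp_units p \<Longrightarrow> s \<in> zp_units p \<Longrightarrow> r * s \<in> zp_units p"
  by (auto simp: zp_units_def)

lemma zp_units_power [simp]: "r \<in> zp_units p \<Longrightarrow> r ^ n \<in> zp_units p"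
  by (induction n) auto

lemma zp_units_inverse [simp]: "r \<in> zp_units p \<Longrightarrow> inverse r \<in> zp_units p"
  by (auto simp: zp_units_def)

lemma zp_units_powi [simp]: "r \<in> zp_units p \<Longrightarrow> r powi k \<in> zp_units p"
  by (auto simp: power_int_def)

lemma zp_units_zp: "r \<in> zp_units p \<Longrightarrow> r \<in> zp p"
  by (simp add: zp_units_def)

lemma zp_units_neq_0: "r \<in> zp_units p \<Longrightarrow> r \<noteq> 0"
  by (simp add: zp_units_def)

lemma zp_units_of_int_iff: "of_int a \<in> zp_units p \<longleftrightarrow> coprime a (int p)"
proof
  assume "coprime a (int p)"
  thus "of_int a \<in> zp_units p"
    using zp_of_int_div[of a 1] p_gt_1 by (auto simp: zp_units_def inverse_eq_divide)
next
  assume a: "of_int a \<in> zp_units p"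
  have "\<not> int p dvd a"
  proof
    assume "int p dvd a"
    then obtain c where "a = int p * c" by auto
    hence "(of_int a :: rat) / of_nat p = of_int c" using p_pos by simp
    with a show False by (simp add: zp_units_iff)
  qed
  thus "coprime a (int p)" by (simp add: coprime_p_iff)
qed

lemma power_diff_in_zp:
  assumes "x \<in> zp p" "y \<in> zp p" "(x - y) / r \<in> zp p"
  shows "(x ^ n - y ^ n) / r \<in> zp p"
proof (induction n)
  case (Suc n)
  have "(x ^ Suc n - y ^ Suc n) / r = x * ((x ^ n - y ^ n) / r) + (x - y) / r * y ^ n"
    by (simp add: algebra_simps flip: add_divide_distrib diff_divide_distrib)
  thus ?case using Suc assms by (simp only: zp_add zp_mult zp_power)
qed simp

text \<open>Negative exponents reduce to natural ones because \<open>1/x - 1/y\<close> is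
  \<open>-(x - y)\<close> times the p-local number \<open>1/(x*y)\<close>. A congruence between
  units thus passes to all integer powers, that is, to all weights.\<close>

lemma powi_diff_in_zp:
  assumes "x \<in> zp_units p" "y \<in> zp_units p" "(x - y) / r \<in> zp p"
  shows "(x powi k - y powi k) / r \<in> zp p"
proof (cases "k \<ge> 0")
  case True
  thus ?thesis using assms by (auto simp: power_int_def zp_units_zp intro!: power_diff_in_zp)
next
  case False
  have "(inverse x - inverse y) / r = - (inverse x * inverse y * ((x - y) / r))"
    using assms(1,2)[THEN zp_units_neq_0]
    by (cases "r = 0") (simp_all add: field_simps)
  also have "\<dots> \<in> zp p"
    using assms by (subst zp_uminus, intro zp_mult) (auto intro: zp_units_zp)
  finally show ?thesis using assms False
    by (auto simp: power_int_def zp_units_zp intro!: power_diff_in_zp)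
qed

section \<open>Polynomials with p-local coefficients\<close>

definition zp_poly :: "rat poly \<Rightarrow> bool" where
  "zp_poly P \<longleftrightarrow> (\<forall>i. coeff P i \<in> zp p)"

lemma zp_poly_pCons [simp]: "zp_poly (pCons a P) \<longleftrightarrow> a \<in> zp p \<and> zp_poly P"
  by (auto simp: zp_poly_def coeff_pCons split: nat.splits)

lemma zp_poly_0 [simp]: "zp_poly 0"
  by (simp add: zp_poly_def)

lemma zp_poly_1 [simp]: "zp_poly 1"
  by (simp add: one_pCons)

lemma zp_poly_add [simp]: "zp_poly P \<Longrightarrow> zp_poly Q \<Longrightarrow> zp_poly (P + Q)"
  by (simp add: zp_poly_def)

lemma zp_poly_diff [simp]: "zp_poly P \<Longrightarrow> zp_poly Q \<Longrightarrow> zp_poly (P - Q)"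
  by (simp add: zp_poly_def)

lemma zp_poly_smult [simp]: "a \<in> zp p \<Longrightarrow> zp_poly P \<Longrightarrow> zp_poly (smult a P)"
  by (simp add: zp_poly_def)

lemma zp_poly_mult [simp]: "zp_poly P \<Longrightarrow> zp_poly Q \<Longrightarrow> zp_poly (P * Q)"
  by (auto simp: zp_poly_def coeff_mult intro!: zp_sum)

lemma zp_poly_power [simp]: "zp_poly P \<Longrightarrow> zp_poly (P ^ n)"
  by (induction n) auto

lemma zp_poly_sum: "(\<And>i. i \<in> F \<Longrightarrow> zp_poly (f i)) \<Longrightarrow> zp_poly (sum f F)"
  by (induction F rule: infinite_finite_induct) auto

lemma zp_poly_prod: "(\<And>i. i \<in> F \<Longrightarrow> zp_poly (f i)) \<Longrightarrow> zp_poly (prod f F)"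
  by (induction F rule: infinite_finite_induct) auto

lemma zp_poly_poly: "zp_poly P \<Longrightarrow> x \<in> zp p \<Longrightarrow> poly P x \<in> zp p"
  by (induction P) auto

lemma zp_poly_synthetic_div: "zp_poly P \<Longrightarrow> c \<in> zp p \<Longrightarrow> zp_poly (synthetic_div P c)"
  by (induction P) (auto simp: zp_poly_poly)

lemma zp_poly_induct [consumes 1, case_names 0 pCons]:
  assumes "zp_poly P" "Q 0" "\<And>a P. a \<in> zp p \<Longrightarrow> zp_poly P \<Longrightarrow> Q P \<Longrightarrow> Q (pCons a P)"
  shows "Q P"
  using assms(1) by (induction P) (use assms in auto)

section \<open>Congruence of polynomials modulo \<open>p\<close> and the Frobenius identity\<close>

definition modp_eq :: "rat poly \<Rightarrow> rat poly \<Rightarrow> bool" where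
  "modp_eq P Q \<longleftrightarrow> zp_poly (smult (1 / of_nat p) (P - Q))"

lemma modp_eq_iff: "modp_eq P Q \<longleftrightarrow> (\<exists>G. zp_poly G \<and> P = Q + smult (of_nat p) G)"
proof
  assume "modp_eq P Q"
  thus "\<exists>G. zp_poly G \<and> P = Q + smult (of_nat p) G"
    unfolding modp_eq_def using p_pos by (intro exI[of _ "smult (1 / of_nat p) (P - Q)"]) auto
qed (use p_pos in \<open>auto simp: modp_eq_def\<close>)

lemma modp_eq_refl [simp]: "modp_eq P P"
  by (simp add: modp_eq_def)

lemma modp_eq_trans [trans]: "modp_eq P Q \<Longrightarrow> modp_eq Q R \<Longrightarrow> modp_eq P R"
  using zp_poly_add[of "smult (1 / of_nat p) (P - Q)" "smult (1 / of_nat p) (Q - R)"]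
  by (simp add: modp_eq_def flip: smult_add_right)

text \<open>From \<open>P*Q - P'*Q' = (P - P')*Q + P'*(Q - Q')\<close>. As \<open>modp_eq\<close>
  only constrains differences, p-locality has to be assumed for the two factors \<open>Q\<close> and
  \<open>P'\<close> of this identity.\<close>

lemma modp_eq_mult:
  assumes "modp_eq P P'" "modp_eq Q Q'" "zp_poly P'" "zp_poly Q"
  shows "modp_eq (P * Q) (P' * Q')"
proof -
  let ?c = "1 / of_nat p :: rat"
  have "smult ?c (P * Q - P' * Q') = smult ?c (P - P') * Q + P' * smult ?c (Q - Q')"
    by (simp add: algebra_simps flip: smult_add_right smult_diff_right)
  thus ?thesis using assms unfolding modp_eq_def by (metis zp_poly_add zp_poly_mult)
qed

lemma modp_eq_power:
  assumes "modp_eq P Q" "zp_poly P" "zp_poly Q"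
  shows "modp_eq (P ^ n) (Q ^ n)"
  by (induction n) (use assms in \<open>auto intro!: modp_eq_mult\<close>)

lemma smult_sum_right: "smult c (sum f F) = (\<Sum>i\<in>F. smult c (f i))"
  by (induction F rule: infinite_finite_induct) (auto simp: smult_add_right)

text \<open>The inner binomial coefficients are multiples of \<open>p\<close>. Oddness of
  \<open>p\<close> makes the constant end term \<open>(-1)^p\<close> equal to
  \<open>-1\<close>.\<close>

lemma modp_eq_frobenius:
  assumes "zp_poly P" "odd p"
  shows "modp_eq ((P - 1) ^ p) (P ^ p - 1)"
proof -
  have "(P - 1) ^ p = (\<Sum>k\<le>p. of_nat (p choose k) * P ^ k * (-1) ^ (p - k))"
    using binomial_ring[of P "-1" p] by simp
  also have "{..p} = insert 0 (insert p {1..<p})" using p_gt_1 by auto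
  also have "(\<Sum>k\<in>insert 0 (insert p {1..<p}). of_nat (p choose k) * P ^ k * (-1) ^ (p - k))
     = P ^ p - 1 + (\<Sum>k\<in>{1..<p}. of_nat (p choose k) * P ^ k * (-1) ^ (p - k))"
    using p_pos assms(2) by simp
  also have "(\<Sum>k\<in>{1..<p}. of_nat (p choose k) * P ^ k * (-1) ^ (p - k))
    = smult (of_nat p) (\<Sum>k\<in>{1..<p}. of_nat ((p choose k) div p) * P ^ k * (-1) ^ (p - k))"
    unfolding smult_sum_right
  proof (intro sum.cong refl)
    fix k assume "k \<in> {1..<p}"
    hence "p dvd (p choose k)" using prime_p by (intro dvd_choose_prime) auto
    hence "(p choose k) = p * ((p choose k) div p)" by simp
    hence "(of_nat (p choose k) :: rat poly) = of_nat p * of_nat ((p choose k) div p)"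
      by (metis of_nat_mult)
    thus "of_nat (p choose k) * P ^ k * (-1) ^ (p - k)
      = smult (of_nat p) (of_nat ((p choose k) div p) * P ^ k * (-1) ^ (p - k))"
      by (simp add: of_nat_poly mult.commute)
  qed
  finally have "(P - 1) ^ p = P ^ p - 1 +
     smult (of_nat p) (\<Sum>k\<in>{1..<p}. of_nat ((p choose k) div p) * P ^ k * (-1) ^ (p - k))" .
  moreover have "zp_poly (\<Sum>k\<in>{1..<p}. of_nat ((p choose k) div p) * P ^ k * (-1) ^ (p - k))"
    using assms zp_poly_diff[of 0 1] by (intro zp_poly_sum zp_poly_mult) (auto simp: of_nat_poly)
  ultimately show ?thesis using modp_eq_iff by blast
qed

lemma modp_eq_frobenius_power:
  assumes "zp_poly P" "odd p"
  shows "modp_eq ((P - 1) ^ (p ^ k)) (P ^ (p ^ k) - 1)"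
proof (induction k)
  case (Suc k)
  have "(P - 1) ^ (p ^ Suc k) = ((P - 1) ^ (p ^ k)) ^ p" by (simp only: power_Suc2 power_mult)
  also have "modp_eq \<dots> ((P ^ (p ^ k) - 1) ^ p)"
    using Suc assms by (intro modp_eq_power) auto
  also have "modp_eq \<dots> ((P ^ (p ^ k)) ^ p - 1)"
    using assms by (intro modp_eq_frobenius) auto
  also have "(P ^ (p ^ k)) ^ p = P ^ (p ^ Suc k)" by (simp only: power_Suc2 power_mult)
  finally show ?case .
qed simp

section \<open>Lagrange interpolation\<close>

definition lagrange_basis :: "rat set \<Rightarrow> rat \<Rightarrow> rat poly" where
  "lagrange_basis A a = (\<Prod>b\<in>A - {a}. smult (1 / (a - b)) [:- b, 1:])"

lemma poly_lagrange_basis: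
  assumes "finite A" "a \<in> A" "b \<in> A"
  shows "poly (lagrange_basis A a) b = (if a = b then 1 else 0)"
proof (cases "a = b")
  case True
  have "poly (smult (1 / (b - c)) [:- c, 1:]) b = 1" if "c \<in> A - {b}" for c
    using that by (simp add: divide_simps)
  thus ?thesis using True by (simp add: lagrange_basis_def poly_prod del: poly_smult)
qed (use assms in \<open>auto simp: lagrange_basis_def poly_prod\<close>)

lemma degree_lagrange_basis:
  assumes "finite A" "a \<in> A"
  shows "degree (lagrange_basis A a) < card A"
proof -
  have "degree (lagrange_basis A a) \<le> (\<Sum>b\<in>A - {a}. degree (smult (1 / (a - b)) [:- b, 1:]))"
    unfolding lagrange_basis_def using assms by (intro degree_prod_sum_le[unfolded o_def]) auto
  also have "\<dots> \<le> (\<Sum>b\<in>A - {a}. 1)" by (intro sum_mono) (auto intro: degree_smult_le[THEN order_trans])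
  also have "\<dots> < card A" using assms card_gt_0_iff[of A] by auto
  finally show ?thesis .
qed

lemma lagrange_interpolation:
  assumes "finite A" "degree P < card A"
  shows "P = (\<Sum>a\<in>A. smult (poly P a) (lagrange_basis A a))"
proof (rule poly_eqI_degree[of A])
  fix x assume "x \<in> A"
  thus "poly P x = poly (\<Sum>a\<in>A. smult (poly P a) (lagrange_basis A a)) x"
    using assms by (simp add: poly_sum poly_lagrange_basis sum.delta' if_distrib cong: if_cong)
next
  show "degree (\<Sum>a\<in>A. smult (poly P a) (lagrange_basis A a)) < card A"
    using assms degree_lagrange_basis
    by (intro degree_sum_less) (auto intro: degree_smult_le[THEN le_less_trans])
qed fact

text \<open>Nodes that are pairwise distinct modulo \<open>p\<close> have unit differences, so their
  Lagrange basis is p-local. Interpolating the p-local values of \<open>P / p\<close> then shows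
  that its coefficients are p-local.\<close>

lemma zp_poly_p_multiple:
  assumes "finite A" "A \<subseteq> zp p" "degree P < card A"
    and "\<And>a. a \<in> A \<Longrightarrow> poly P a / of_nat p \<in> zp p"
    and "\<And>a b. a \<in> A \<Longrightarrow> b \<in> A \<Longrightarrow> a \<noteq> b \<Longrightarrow> (a - b) / of_nat p \<notin> zp p"
  shows "zp_poly (smult (1 / of_nat p) P)"
proof -
  have "smult (1 / of_nat p) P = (\<Sum>a\<in>A. smult (poly P a / of_nat p) (lagrange_basis A a))"
    using arg_cong[OF lagrange_interpolation[OF assms(1,3)], of "smult (1 / of_nat p)"]
    by (simp add: smult_sum_right)
  moreover have "zp_poly (lagrange_basis A a)" if "a \<in> A" for a
    unfolding lagrange_basis_def
  proof (intro zp_poly_prod zp_poly_smult)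
    fix b assume b: "b \<in> A - {a}"
    hence "a - b \<in> zp p" using that assms(2) by (intro zp_diff) auto
    with b show "1 / (a - b) \<in> zp p" "zp_poly [:- b, 1:]"
      using that assms(2) assms(5)[of a b] zp_inverse[of "a - b"] by (auto simp: inverse_eq_divide)
  qed
  ultimately show ?thesis using assms by (auto intro!: zp_poly_sum)
qed

end

section \<open>Interpolation at powers of q and the ring A\<close>

text \<open>In \<open>x^m - 1 = (x - 1) * (1 + x + ... + x^(m-1))\<close> both factors are divisible
  by \<open>m\<close>. It transfers primitivity of \<open>q\<close> from \<open>p^2\<close> down to
  \<open>p\<close>.\<close>

lemma cong_1_imp_power_cong_1:
  fixes x m :: int
  assumes "[x = 1] (mod m)"
  shows "[x ^ nat m = 1] (mod m ^ 2)"
proof (cases "m \<ge> 0")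
  case True
  have "[(\<Sum>i<nat m. x ^ i) = (\<Sum>i<nat m. 1 ^ i)] (mod m)"
    using assms by (intro cong_sum cong_pow)
  hence "m dvd (\<Sum>i<nat m. x ^ i)" using True by (auto simp: cong_0_iff[symmetric] cong_def)
  moreover have "m dvd x - 1" using assms by (simp add: cong_iff_dvd_diff)
  ultimately have "m * m dvd (x - 1) * (\<Sum>i<nat m. x ^ i)" by (intro mult_dvd_mono)
  thus ?thesis by (simp add: cong_iff_dvd_diff power_diff_1_eq power2_eq_square)
qed auto

lemma qexp_even [simp]: "qexp (2 * n) = int n" and qexp_odd [simp]: "qexp (Suc (2 * n)) = - int n"
  by (auto simp: qexp_def)

text \<open>From index \<open>1\<close> on, the exponents run through
  \<open>0, 1, -1, 2, -2, ...\<close>. Index \<open>0\<close> would repeat the exponent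
  \<open>0\<close>.\<close>

lemma inj_on_qexp: "inj_on qexp {1..}"
proof (rule inj_onI)
  fix i j :: nat assume "i \<in> {1..}" "j \<in> {1..}" "qexp i = qexp j"
  thus "i = j"
    by (cases "even i"; cases "even j"; auto elim!: evenE oddE)
qed

lemma qexp_surj: obtains i where "i \<ge> 1" "i \<le> nat (2 * \<bar>k\<bar> + 1)" "qexp i = k"
proof (cases "k > 0")
  case True
  thus ?thesis using that[of "2 * nat k"] by auto
next
  case False
  thus ?thesis using that[of "Suc (2 * nat (- k))"] by auto
qed

text \<open>The cut-off in \<open>A_elem\<close> at weight \<open>qexp i\<close> is at least
  \<open>i\<close>, so it drops only terms that vanish at that weight.\<close>

lemma le_qexp: "i \<le> nat (2 * \<bar>qexp i\<bar> + 1)"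
  by (cases "even i") (auto elim!: evenE oddE)

section \<open>Powers of \<open>q\<close> modulo powers of \<open>p\<close>\<close>

locale adams_base = p_local +
  fixes q :: int
  assumes odd_p: "odd p" and primitive_q: "primitive_mod (int (p ^ 2)) q"
begin

abbreviation Q :: rat where "Q \<equiv> of_int q"

lemma p_ge_3: "p \<ge> 3"
  using p_gt_1 odd_p by (cases "p = 2") auto

lemma totient_p2: "totient (p ^ 2) = p * (p - 1)"
  using totient_prime_power[OF prime_p, of 2] by simp

lemma coprime_q: "coprime q (int p)"
  using primitive_q p_pos by (simp add: primitive_mod_def)

lemma power_q_neq_1_p2: "0 < k \<Longrightarrow> k < p * (p - 1) \<Longrightarrow> \<not> [q ^ k = 1] (mod (int p)^2)"
proof -
  assume k: "0 < k" "k < p * (p - 1)"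
  have "\<forall>k::nat. 0 < k \<and> k < totient (p ^ 2) \<longrightarrow> \<not> [q ^ k = 1] (mod int (p ^ 2))"
    using primitive_q unfolding primitive_mod_def nat_int by (rule conjunct2)
  from this[rule_format, of k] k show ?thesis unfolding totient_p2 by simp
qed

text \<open>If \<open>q^k\<close> were \<open>1\<close> modulo \<open>p\<close>, then
  \<open>q^(k*p)\<close> would be \<open>1\<close> modulo \<open>p^2\<close>, although
  \<open>k*p\<close> is below \<open>p*(p-1)\<close>.\<close>

lemma power_q_neq_1_p: "0 < k \<Longrightarrow> k < p - 1 \<Longrightarrow> \<not> [q ^ k = 1] (mod (int p))"
  using cong_1_imp_power_cong_1[of "q ^ k" p] power_q_neq_1_p2[of "k * p"] p_pos
  by (auto simp flip: power_mult simp: mult.commute)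

text \<open>Otherwise \<open>q\<close> is a unit of the integers, so \<open>q^2 = 1\<close>; but
  \<open>2\<close> is smaller than the order \<open>p*(p-1)\<close> of \<open>q\<close> modulo
  \<open>p^2\<close>.\<close>

lemma power_q_neq_1: "k > 0 \<Longrightarrow> q ^ k \<noteq> 1"
proof
  assume "k > 0" "q ^ k = 1"
  hence "q dvd 1" by (metis dvd_power)
  hence "q ^ 2 = 1" by (auto simp: abs_if split: if_splits)
  moreover have "3 * 2 \<le> p * (p - 1)" using p_ge_3 by (intro mult_mono) auto
  ultimately show False using power_q_neq_1_p2[of 2] by auto
qed

lemma ord_eqI:
  fixes g n :: nat
  assumes "n > 0" "coprime n g" "\<And>k. 0 < k \<Longrightarrow> k < totient n \<Longrightarrow> \<not> [g ^ k = 1] (mod n)"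
  shows "ord n g = totient n"
proof -
  have "\<not> ord n g < totient n"
    using assms ord_works[of g n] by auto
  moreover have "ord n g dvd totient n" 
    using assms(2) order_divides_totient by blast
  ultimately show ?thesis
    using assms(1) dvd_imp_le[of "ord n g" "totient n"] by simp
qed

text \<open>A primitive root modulo an odd prime \<open>p\<close> whose power \<open>p - 1\<close>
  is not \<open>1\<close> modulo \<open>p^2\<close> generates the units modulo every power of
  \<open>p\<close>. The natural number \<open>g\<close> replaces \<open>q\<close>, which may be
  negative.\<close>

lemma q_generates:
  assumes "coprime a (int p)"
  obtains s where "[q ^ s = a] (mod (int p) ^ N)"
proof -
  \<comment> \<open>With exponent at least \<open>2\<close>, congruence of \<open>g\<close> and
    \<open>q\<close> modulo \<open>p^M\<close> determines both modulo \<open>p^2\<close>, also for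
    \<open>N < 2\<close>.\<close>
  define M where "M = Suc (Suc N)"
  define g where "g = nat (q mod int p ^ M)"
  have pM: "int p ^ M > 0" using p_pos by simp
  have gq: "[int g = q] (mod int p ^ M)" unfolding g_def using pM by (simp add: cong_def)
  have gq1: "[int g = q] (mod int p)" and gq2: "[int g = q] (mod int p ^ 2)"
    using cong_dvd_modulus[OF gq, of "int p ^ 1"] cong_dvd_modulus[OF gq, of "int p ^ 2"]
      le_imp_power_dvd[of 1 M "int p"] le_imp_power_dvd[of 2 M "int p"] unfolding M_def by auto
  have "coprime (int g) (int p)" using cong_imp_coprime[OF cong_sym[OF gq1]] coprime_q by simp
  hence gp: "coprime p g" by (simp add: coprime_commute)
  have neq: "\<not> [g ^ k = 1] (mod m)"
    if "[int g = q] (mod int m)" "\<not> [q ^ k = 1] (mod int m)" for k m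
    using that cong_pow[OF that(1), of k] cong_trans[of "q ^ k" "int g ^ k" "int m" 1]
    by (auto simp: cong_sym_eq simp flip: cong_int_iff)
  have "residue_primroot p g"
    unfolding residue_primroot_def
  proof (intro conjI ord_eqI)
    fix k assume "0 < k" "k < totient p"
    thus "\<not> [g ^ k = 1] (mod p)"
      using neq[OF gq1] power_q_neq_1_p totient_prime[OF prime_p] by metis
  qed (use p_pos gp in auto)
  moreover have "[g ^ (p - 1) \<noteq> 1] (mod p\<^sup>2)"
    using neq[of "p\<^sup>2" "p - 1"] gq2 power_q_neq_1_p2[of "p - 1"] p_ge_3 by simp
  moreover have "M > 0" by (simp add: M_def)
  ultimately have "residue_primroot (p ^ M) g"
    using residue_primroot_prime_lift_iff[OF prime_p odd_p] by blast
  moreover have "p ^ M > 1" using p_gt_1 unfolding M_def by (intro one_less_power) auto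
  ultimately have "bij_betw (\<lambda>i. g ^ i mod p ^ M) {..<totient (p ^ M)} (totatives (p ^ M))"
    by (intro residue_primroot_is_generator)
  moreover have "nat (a mod int p ^ M) \<in> totatives (p ^ M)"
  proof -
    have "coprime (a mod int p ^ M) (int p ^ M)"
      by (subst coprime_mod_left_iff) (use assms pM in auto)
    moreover have "a mod int p ^ M \<ge> 0" "a mod int p ^ M < int p ^ M" using pM by auto
    moreover have "a mod int p ^ M \<noteq> 0"
      using calculation(1) \<open>p ^ M > 1\<close> by (auto simp: M_def)
    ultimately show ?thesis
      by (auto simp: totatives_def nat_le_iff nat_0_iff coprime_int_iff[symmetric] simp del: coprime_int_iff)
  qed
  ultimately obtain s where "nat (a mod int p ^ M) = g ^ s mod p ^ M"
    by (force simp: bij_betw_def)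
  hence "a mod int p ^ M = int (g ^ s mod p ^ M)" using pM by (metis int_nat_eq pos_mod_sign)
  hence "[a = int g ^ s] (mod int p ^ M)" by (simp add: cong_def zmod_int)
  also have "[int g ^ s = q ^ s] (mod int p ^ M)" using gq by (intro cong_pow)
  finally have "[q ^ s = a] (mod int p ^ M)" by (rule cong_sym)
  hence "[q ^ s = a] (mod int p ^ N)" by (rule cong_dvd_modulus) (auto simp: M_def)
  thus ?thesis by (rule that)
qed

lemma Q_unit [simp]: "Q \<in> zp_units p"
  by (simp add: zp_units_of_int_iff coprime_q)

lemma q_neq_0 [simp]: "q \<noteq> 0"
  using zp_units_neq_0[OF Q_unit] by simp

text \<open>Powers of \<open>q\<close> are p-adically dense in the units: for
  \<open>j = a / b\<close>, approximate \<open>a\<close> times an inverse of \<open>b\<close> modulo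
  a power of \<open>p\<close>.\<close>

lemma zp_units_approx:
  assumes "j \<in> zp_units p"
  obtains s where "(j - Q ^ s) / of_nat p ^ N \<in> zp p"
proof -
  obtain a b where ab: "coprime b (int p)" "b \<noteq> 0" "j = of_int a / of_int b"
    using zpE[OF zp_units_zp[OF assms]] by metis
  have "of_int a = j * of_int b" using ab by simp
  also have "\<dots> \<in> zp_units p" using assms ab(1) by (intro zp_units_mult) (simp_all add: zp_units_of_int_iff)
  finally have a: "coprime a (int p)" by (simp add: zp_units_of_int_iff)
  \<comment> \<open>The exponent \<open>Suc N\<close> keeps the modulus divisible by
    \<open>p\<close> when \<open>N = 0\<close>, which makes \<open>c\<close> prime to
    \<open>p\<close>.\<close>
  obtain c where c: "[b * c = 1] (mod int p ^ Suc N)"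
    using cong_solve_coprime_int[of b "int p ^ Suc N"] ab by auto
  have "\<not> int p dvd c"
  proof
    assume "int p dvd c"
    moreover have "int p dvd b * c - 1"
      using c dvd_trans[of "int p" "int p ^ Suc N"] by (simp add: cong_iff_dvd_diff)
    ultimately have "int p dvd 1" by (metis dvd_diff_right_iff dvd_mult)
    thus False using p_gt_1 by simp
  qed
  hence "coprime c (int p)" by (simp add: coprime_p_iff)
  with a have "coprime (a * c) (int p)" by simp
  then obtain s where s: "[q ^ s = a * c] (mod int p ^ N)" by (rule q_generates)
  have "[b * q ^ s = b * (a * c)] (mod int p ^ N)" using s by (rule cong_scalar_left)
  also have "b * (a * c) = a * (b * c)" by simp
  also have "[a * (b * c) = a * 1] (mod int p ^ N)"
    using c by (intro cong_scalar_left) (auto intro: cong_dvd_modulus)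
  finally have "[a = b * q ^ s] (mod int p ^ N)" by (simp add: cong_sym_eq)
  then obtain e where e: "a - b * q ^ s = int p ^ N * e"
    by (auto simp: cong_iff_dvd_diff)
  have "j - Q ^ s = of_int (a - b * q ^ s) / of_int b" using ab by (simp add: field_simps)
  also have "\<dots> / of_nat p ^ N = of_int e / of_int b" unfolding e using p_pos by simp
  finally show ?thesis using that[of s] zp_of_int_div[OF ab(1)] by simp
qed

text \<open>Up to a unit the difference is \<open>q^d - 1\<close> with \<open>0 < d < p - 1\<close>.
  Hence any \<open>p - 1\<close> consecutive powers of \<open>q\<close> are distinct modulo
  \<open>p\<close> and can serve as interpolation nodes.\<close>

lemma Q_powi_diff:
  assumes "e \<noteq> e'" "\<bar>e - e'\<bar> < int p - 1"
  shows "(Q powi e - Q powi e') / of_nat p \<notin> zp p"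
proof -
  have *: "(Q powi (e + int d) - Q powi e) / of_nat p \<notin> zp p" if d: "0 < d" "d < p - 1" for e d
  proof
    assume *: "(Q powi (e + int d) - Q powi e) / of_nat p \<in> zp p"
    have "inverse (Q powi e) * ((Q powi (e + int d) - Q powi e) / of_nat p) \<in> zp p"
      using * by (intro zp_mult) (auto intro: zp_units_zp)
    also have "inverse (Q powi e) * ((Q powi (e + int d) - Q powi e) / of_nat p)
        = of_int (q ^ d - 1) / of_nat p"
    proof -
      have "Q powi (e + int d) - Q powi e = Q powi e * (Q ^ d - 1)"
        by (simp add: power_int_add algebra_simps)
      thus ?thesis by simp
    qed
    finally have "of_int (q ^ d - 1) \<notin> zp_units p" by (simp add: zp_units_iff)
    hence "int p dvd q ^ d - 1" by (simp add: zp_units_of_int_iff coprime_p_iff del: of_int_diff)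
    thus False using power_q_neq_1_p[OF d] by (simp add: cong_iff_dvd_diff)
  qed
  show ?thesis
  proof (cases "e > e'")
    case True
    thus ?thesis using *[of "nat (e - e')" e'] assms by simp
  next
    case False
    hence "(Q powi e' - Q powi e) / of_nat p \<notin> zp p"
      using *[of "nat (e' - e)" e] assms by simp
    moreover have "(Q powi e' - Q powi e) / of_nat p = - ((Q powi e - Q powi e') / of_nat p)"
      by (simp add: diff_divide_distrib)
    ultimately show ?thesis by (metis zp_uminus)
  qed
qed

lemma inj_Q_powi: "inj (\<lambda>e. Q powi e)"
proof (rule injI, rule ccontr)
  have *: "Q powi e \<noteq> Q powi e'" if "e < e'" for e e'
  proof
    assume "Q powi e = Q powi e'"
    also have "Q powi e' = Q powi e * Q powi (e' - e)" by (simp flip: power_int_add)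
    finally have "Q powi (e' - e) = 1" by simp
    hence "of_int (q ^ nat (e' - e)) = (1 :: rat)" using that by (simp add: power_int_def)
    hence "q ^ nat (e' - e) = 1" by (simp only: of_int_eq_1_iff)
    thus False using power_q_neq_1[of "nat (e' - e)"] that by simp
  qed
  fix e e' assume "Q powi e = Q powi e'" "e \<noteq> e'"
  thus False using *[of e e'] *[of e' e] by (cases "e < e'") auto
qed

lemma qi_unit [simp]: "qi q i \<in> zp_units p" and qi_zp [simp]: "qi q i \<in> zp p"
  by (auto simp: qi_def intro: zp_units_zp)

lemma qi_eq_iff: "i \<ge> 1 \<Longrightarrow> j \<ge> 1 \<Longrightarrow> qi q i = qi q j \<longleftrightarrow> i = j"
  using inj_on_qexp inj_Q_powi by (auto simp: qi_def inj_on_def)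

lemma Theta_qi_eq_0_iff: "i \<ge> 1 \<Longrightarrow> Theta q n (qi q i) = 0 \<longleftrightarrow> i \<le> n"
  by (auto simp: Theta_def qi_eq_iff)

section \<open>Newton expansion in the polynomials \<open>Theta_poly n\<close>\<close>

definition Theta_poly :: "nat \<Rightarrow> rat poly" where
  "Theta_poly n = (\<Prod>i\<in>{1..n}. [:- qi q i, 1:])"

lemma poly_Theta_poly [simp]: "poly (Theta_poly n) x = Theta q n x"
  by (simp add: Theta_poly_def Theta_def poly_prod)

lemma Theta_poly_0 [simp]: "Theta_poly 0 = 1"
  by (simp add: Theta_poly_def)

lemma Theta_poly_Suc: "Theta_poly (Suc n) = Theta_poly n * [:- qi q (Suc n), 1:]"
  by (simp add: Theta_poly_def mult.commute)

lemma zp_poly_Theta_poly [simp]: "zp_poly (Theta_poly n)"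
  by (auto simp: Theta_poly_def intro!: zp_poly_prod)

lemma Theta_poly_dvd: "m \<le> n \<Longrightarrow> \<exists>R. zp_poly R \<and> Theta_poly n = R * Theta_poly m"
proof (induction n rule: dec_induct)
  case base
  show ?case by (intro exI[of _ 1]) auto
next
  case (step n)
  then obtain R where "zp_poly R" "Theta_poly n = R * Theta_poly m" by blast
  thus ?case by (intro exI[of _ "R * [:- qi q (Suc n), 1:]"]) (simp_all add: Theta_poly_Suc mult_ac del: mult_pCons_left mult_pCons_right)
qed

text \<open>Divide the current quotient \<open>R\<close> by \<open>X - q_(n+1)\<close>: the
  remainder is the next coefficient, and division by a monic linear polynomial preserves
  p-locality.\<close>

lemma newton_expansion:
  assumes "zp_poly P"
  obtains b R where "\<And>m. b m \<in> zp p" "zp_poly R"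
    "P = (\<Sum>m<n. smult (b m) (Theta_poly m)) + R * Theta_poly n"
proof -
  have "\<exists>b R. (\<forall>m. b m \<in> zp p) \<and> zp_poly R \<and>
    P = (\<Sum>m<n. smult (b m) (Theta_poly m)) + R * Theta_poly n"
  proof (induction n)
    case 0
    show ?case using assms by (intro exI[of _ "\<lambda>_. 0"] exI[of _ P]) auto
  next
    case (Suc n)
    then obtain b R where bR: "\<forall>m. b m \<in> zp p" "zp_poly R"
      "P = (\<Sum>m<n. smult (b m) (Theta_poly m)) + R * Theta_poly n" by blast
    define c where "c = poly R (qi q (Suc n))"
    define S where "S = synthetic_div R (qi q (Suc n))"
    have "R = [:- qi q (Suc n), 1:] * S + [:c:]"
      unfolding c_def S_def by (rule synthetic_div_correct'[symmetric])
    hence "R * Theta_poly n = ([:- qi q (Suc n), 1:] * S + [:c:]) * Theta_poly n" by simp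
    also have "\<dots> = smult c (Theta_poly n) + S * Theta_poly (Suc n)"
    proof -
      have "Theta_poly n * [:c:] = smult c (Theta_poly n)" by simp
      thus ?thesis unfolding distrib_right Theta_poly_Suc by (simp only: mult_ac add_ac)
    qed
    finally have "P = (\<Sum>m<Suc n. smult ((b(n := c)) m) (Theta_poly m)) + S * Theta_poly (Suc n)"
      using bR(3) by (simp add: add.assoc)
    moreover have "c \<in> zp p" "zp_poly S"
      using bR(2) by (auto simp: c_def S_def zp_poly_poly zp_poly_synthetic_div)
    ultimately show ?case using bR(1) by (intro exI[of _ "b(n := c)"] exI[of _ S]) auto
  qed
  thus ?thesis using that by blast
qed

text \<open>\<open>Theta q m\<close> vanishes at \<open>qi q i\<close> as soon as
  \<open>m \<ge> i\<close>, so only the terms with \<open>m < i\<close> contribute.\<close>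

lemma newton_sum_truncate:
  assumes "1 \<le> i" "i \<le> n" "i \<le> n'"
  shows "(\<Sum>m<n. b m * Theta q m (qi q i)) = (\<Sum>m<n'. b m * Theta q m (qi q i))"
proof -
  have *: "(\<Sum>m<n. b m * Theta q m (qi q i)) = (\<Sum>m<i. b m * Theta q m (qi q i))" if "i \<le> n" for n
    using assms(1) that by (intro sum.mono_neutral_right) (auto simp: Theta_qi_eq_0_iff)
  show ?thesis using *[of n] *[of n'] assms by (simp only:)
qed

text \<open>The system is triangular: at the node with index \<open>Suc m\<close> the last surviving
  term is the one for \<open>m\<close>, and \<open>Theta q m\<close> is nonzero there.\<close>

lemma newton_coeffs_unique:
  assumes "\<And>i. i \<in> {1..n} \<Longrightarrow>
    (\<Sum>m<n. a m * Theta q m (qi q i)) = (\<Sum>m<n. b m * Theta q m (qi q i))"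
  shows "m < n \<Longrightarrow> a m = b m"
proof (induction m rule: less_induct)
  case (less m)
  have "(\<Sum>k<Suc m. a k * Theta q k (qi q (Suc m))) = (\<Sum>k<Suc m. b k * Theta q k (qi q (Suc m)))"
    using assms[of "Suc m"] less.prems newton_sum_truncate[of "Suc m" n "Suc m" a]
      newton_sum_truncate[of "Suc m" n "Suc m" b] by (simp del: sum.lessThan_Suc)
  moreover have "(\<Sum>k<m. a k * Theta q k (qi q (Suc m))) = (\<Sum>k<m. b k * Theta q k (qi q (Suc m)))"
    using less by (intro sum.cong) auto
  ultimately show ?case using Theta_qi_eq_0_iff[of "Suc m" m] by simp
qed

text \<open>All Newton coefficients below \<open>n\<close> vanish by uniqueness, so only the
  remainder term is left. This route yields a p-local quotient.\<close>

lemma Theta_poly_factor: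
  assumes "zp_poly P" "\<And>i. i \<in> {1..n} \<Longrightarrow> poly P (qi q i) = 0"
  obtains R where "zp_poly R" "P = R * Theta_poly n"
proof -
  obtain b R where bR: "\<And>m. b m \<in> zp p" "zp_poly R"
    "P = (\<Sum>m<n. smult (b m) (Theta_poly m)) + R * Theta_poly n"
    using newton_expansion[OF assms(1)] by metis
  have "b m = 0" if "m < n" for m
  proof (rule newton_coeffs_unique[of n b "\<lambda>_. 0", OF _ that])
    fix i assume i: "i \<in> {1..n}"
    hence "Theta q n (qi q i) = 0" by (simp add: Theta_qi_eq_0_iff)
    thus "(\<Sum>m<n. b m * Theta q m (qi q i)) = (\<Sum>m<n. 0 * Theta q m (qi q i))"
      using assms(2)[OF i] unfolding bR(3) by (simp add: poly_sum Theta_qi_eq_0_iff)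
  qed
  hence "P = R * Theta_poly n" using bR(3) by simp
  with bR(2) show ?thesis by (rule that)
qed

section \<open>The ring \<open>A\<close> through agreement with polynomials at finitely many
  weights\<close>

definition agrees :: "nat \<Rightarrow> (int \<Rightarrow> rat) \<Rightarrow> rat poly \<Rightarrow> bool" where
  "agrees n f P \<longleftrightarrow> (\<forall>i\<in>{1..n}. f (qexp i) = poly P (qi q i))"

lemma agrees_mono: "agrees n f P \<Longrightarrow> m \<le> n \<Longrightarrow> agrees m f P"
  by (auto simp: agrees_def)

lemma agrees_add: "agrees n f P \<Longrightarrow> agrees n g R \<Longrightarrow> agrees n (\<lambda>k. f k + g k) (P + R)"
  by (auto simp: agrees_def)

lemma agrees_diff: "agrees n f P \<Longrightarrow> agrees n g R \<Longrightarrow> agrees n (\<lambda>k. f k - g k) (P - R)"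
  by (auto simp: agrees_def)

lemma agrees_mult: "agrees n f P \<Longrightarrow> agrees n g R \<Longrightarrow> agrees n (\<lambda>k. f k * g k) (P * R)"
  by (auto simp: agrees_def)

lemma agrees_poly: "agrees n (\<lambda>k. poly P (Q powi k)) P"
  by (auto simp: agrees_def qi_def)

lemma agrees_const: "agrees n (const_op c) [:c:]"
  by (auto simp: agrees_def const_op_def)

lemma A_elem_qexp:
  assumes "i \<in> {1..n}"
  shows "A_elem q a (qexp i) = (\<Sum>m<n. a m * Theta q m (qi q i))"
proof -
  have "A_elem q a (qexp i) = (\<Sum>m<Suc (nat (2 * \<bar>qexp i\<bar> + 1)). a m * Theta q m (qi q i))"
    by (simp only: A_elem_def Phi_def qi_def lessThan_Suc_atMost)
  also have "\<dots> = (\<Sum>m<n. a m * Theta q m (qi q i))"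
    using assms le_qexp[of i] by (intro newton_sum_truncate) auto
  finally show ?thesis .
qed

lemma eq_if_eq_on_qexp:
  assumes "\<And>i. i \<ge> 1 \<Longrightarrow> f (qexp i) = g (qexp i)"
  shows "f = g"
  using assms qexp_surj by (metis ext)

text \<open>For \<open>f\<close> in \<open>A\<close> and p-local \<open>P\<close>,
  \<open>agrees n f P\<close> is congruence modulo \<open>Afilt p q n\<close>, so this describes
  \<open>A\<close> as a completion of the polynomials in the Adams operation of \<open>q\<close>. It
  makes closure under products immediate.\<close>

lemma Aset_iff: "f \<in> Aset p q \<longleftrightarrow> (\<forall>n. \<exists>P. zp_poly P \<and> agrees n f P)"
proof
  assume "f \<in> Aset p q"
  then obtain a where a: "f = A_elem q a" "\<And>m. a m \<in> zp p" by (auto simp: Aset_def)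
  show "\<forall>n. \<exists>P. zp_poly P \<and> agrees n f P"
  proof
    fix n
    show "\<exists>P. zp_poly P \<and> agrees n f P"
      using a A_elem_qexp
      by (intro exI[of _ "\<Sum>m<n. smult (a m) (Theta_poly m)"])
         (auto simp: agrees_def poly_sum intro!: zp_poly_sum)
  qed
next
  assume *: "\<forall>n. \<exists>P. zp_poly P \<and> agrees n f P"
  have "\<exists>b. (\<forall>m. b m \<in> zp p) \<and> (\<forall>i\<in>{1..n}. f (qexp i) = (\<Sum>m<n. b m * Theta q m (qi q i)))" for n
  proof -
    obtain P where P: "zp_poly P" "agrees n f P" using * by blast
    obtain b R where bR: "\<And>m. b m \<in> zp p" "zp_poly R"
      "P = (\<Sum>m<n. smult (b m) (Theta_poly m)) + R * Theta_poly n"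
      using newton_expansion[OF P(1)] by metis
    show ?thesis
      using bR(1) P(2) unfolding bR(3)
      by (intro exI[of _ b]) (auto simp: agrees_def poly_sum Theta_qi_eq_0_iff)
  qed
  then obtain b where b: "\<And>n m. b n m \<in> zp p"
    "\<And>n i. i \<in> {1..n} \<Longrightarrow> f (qexp i) = (\<Sum>m<n. b n m * Theta q m (qi q i))" by metis
  \<comment> \<open>The polynomials chosen for different \<open>n\<close> are unrelated, but
    uniqueness of Newton coefficients makes the expansions compatible; the diagonal sequence is then
    the global one.\<close>
  have b_eq: "b n m = b (Suc m) m" if "m < n" for n m
  proof (rule newton_coeffs_unique[of "Suc m" "b n" "b (Suc m)"])
    fix i assume "i \<in> {1..Suc m}"
    thus "(\<Sum>k<Suc m. b n k * Theta q k (qi q i)) = (\<Sum>k<Suc m. b (Suc m) k * Theta q k (qi q i))"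
      using b(2)[of i n] b(2)[of i "Suc m"] newton_sum_truncate[of i "Suc m" n] that by simp
  qed simp
  have "f = A_elem q (\<lambda>m. b (Suc m) m)"
  proof (rule eq_if_eq_on_qexp)
    fix i :: nat assume "i \<ge> 1"
    hence "f (qexp i) = (\<Sum>m<i. b i m * Theta q m (qi q i))" using b(2)[of i i] by simp
    also have "\<dots> = (\<Sum>m<i. b (Suc m) m * Theta q m (qi q i))"
      using b_eq[of _ i] by (intro sum.cong) auto
    also have "\<dots> = A_elem q (\<lambda>m. b (Suc m) m) (qexp i)"
      using A_elem_qexp[of i i] \<open>i \<ge> 1\<close> by simp
    finally show "f (qexp i) = A_elem q (\<lambda>m. b (Suc m) m) (qexp i)" .
  qed
  thus "f \<in> Aset p q" using b(1) by (auto simp: Aset_def)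
qed

lemma Aset_poly [simp]: "zp_poly P \<Longrightarrow> (\<lambda>k. poly P (Q powi k)) \<in> Aset p q"
  using agrees_poly by (auto simp: Aset_iff)

lemma Aset_add: "f \<in> Aset p q \<Longrightarrow> g \<in> Aset p q \<Longrightarrow> (\<lambda>k. f k + g k) \<in> Aset p q"
  unfolding Aset_iff by (metis agrees_add zp_poly_add)

lemma Aset_diff: "f \<in> Aset p q \<Longrightarrow> g \<in> Aset p q \<Longrightarrow> (\<lambda>k. f k - g k) \<in> Aset p q"
  unfolding Aset_iff by (metis agrees_diff zp_poly_diff)

lemma Aset_mult: "f \<in> Aset p q \<Longrightarrow> g \<in> Aset p q \<Longrightarrow> (\<lambda>k. f k * g k) \<in> Aset p q"
  unfolding Aset_iff by (metis agrees_mult zp_poly_mult)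

lemma Aset_const [simp]: "c \<in> zp p \<Longrightarrow> const_op c \<in> Aset p q"
  using Aset_poly[of "[:c:]"] by (simp add: const_op_def)

lemma Afilt_subset_Aset: "Afilt p q n \<subseteq> Aset p q"
  by (auto simp: Afilt_def Aset_def)

lemma Afilt_iff: "f \<in> Afilt p q n \<longleftrightarrow> f \<in> Aset p q \<and> (\<forall>i\<in>{1..n}. f (qexp i) = 0)"
proof
  assume "f \<in> Afilt p q n"
  thus "f \<in> Aset p q \<and> (\<forall>i\<in>{1..n}. f (qexp i) = 0)"
    using A_elem_qexp[of _ n] by (auto simp: Afilt_def Aset_def)
next
  assume *: "f \<in> Aset p q \<and> (\<forall>i\<in>{1..n}. f (qexp i) = 0)"
  then obtain a where a: "f = A_elem q a" "\<And>m. a m \<in> zp p" by (auto simp: Aset_def)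
  have "a m = 0" if "m < n" for m
    using * a A_elem_qexp[of _ n a]
    by (intro newton_coeffs_unique[of n a "\<lambda>_. 0", OF _ that]) auto
  thus "f \<in> Afilt p q n" using a by (auto simp: Afilt_def)
qed

text \<open>These are Lagrange basis polynomials for the first \<open>n\<close> nodes, multiplied by
  a common power of \<open>p\<close> that clears their denominators; on those weights they act as
  \<open>p^C\<close> times the projections.\<close>

lemma delta_polys:
  obtains C D where "\<And>i. i \<in> {1..n} \<Longrightarrow> zp_poly (D i)"
    "\<And>i l. i \<in> {1..n} \<Longrightarrow> l \<in> {1..n} \<Longrightarrow>
       poly (D i) (qi q l) = (if i = l then of_nat p ^ C else 0)"
proof -
  define E where "E i = (\<Prod>l\<in>{1..n} - {i}. [:- qi q l, 1:])" for i
  define e where "e i = poly (E i) (qi q i)" for i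
  have e: "e i \<noteq> 0" if "i \<ge> 1" for i
    using that by (auto simp: e_def E_def poly_prod qi_eq_iff)
  obtain c where c: "\<And>i. i \<ge> 1 \<Longrightarrow> of_nat p ^ c i / e i \<in> zp p"
    using p_power_over_in_zp[OF e] by metis
  define C where "C = (\<Sum>i\<in>{1..n}. c i)"
  have C: "of_nat p ^ C / e i \<in> zp p" if "i \<in> {1..n}" for i
  proof -
    have "c i \<le> C" unfolding C_def using that by (intro member_le_sum) auto
    hence "(of_nat p :: rat) ^ C = of_nat (p ^ (C - c i)) * of_nat p ^ c i"
      by (simp flip: power_add)
    hence "of_nat p ^ C / e i = of_nat (p ^ (C - c i)) * (of_nat p ^ c i / e i)" by simp
    thus ?thesis using c[of i] that by (metis atLeastAtMost_iff zp_mult zp_of_nat)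
  qed
  show ?thesis
  proof (rule that[of "\<lambda>i. smult (of_nat p ^ C / e i) (E i)" C])
    fix i assume i: "i \<in> {1..n}"
    show "zp_poly (smult (of_nat p ^ C / e i) (E i))"
      using C[OF i] by (auto simp: E_def intro!: zp_poly_smult zp_poly_prod)
    fix l assume l: "l \<in> {1..n}"
    show "poly (smult (of_nat p ^ C / e i) (E i)) (qi q l) = (if i = l then of_nat p ^ C else 0)"
    proof (cases "i = l")
      case True
      thus ?thesis using e[of l] l by (simp add: e_def)
    next
      case False
      hence "poly (E i) (qi q l) = 0" using l by (auto simp: E_def poly_prod)
      thus ?thesis using False by simp
    qed
  qed
qed

text \<open>If \<open>j\<close> and \<open>j'\<close> agree modulo \<open>p^(C+m)\<close>, so do
  their powers at each weight. Interpolating these values costs the factor \<open>p^C\<close>,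
  leaving divisibility by \<open>p^m\<close>, with \<open>C\<close> depending on \<open>n\<close>
  alone.\<close>

lemma adams_diff:
  obtains C where "\<And>j j' m. j \<in> zp_units p \<Longrightarrow> j' \<in> zp_units p \<Longrightarrow>
     (j - j') / of_nat p ^ (C + m) \<in> zp p \<Longrightarrow>
     \<exists>H. zp_poly H \<and> agrees n (\<lambda>k. adams j k - adams j' k) (smult (of_nat p ^ m) H)"
proof -
  obtain C D where D: "\<And>i. i \<in> {1..n} \<Longrightarrow> zp_poly (D i)"
    "\<And>i l. i \<in> {1..n} \<Longrightarrow> l \<in> {1..n} \<Longrightarrow>
       poly (D i) (qi q l) = (if i = l then of_nat p ^ C else 0)"
    using delta_polys[where n = n] by metis
  show ?thesis
  proof (rule that[of C])
    fix j j' m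
    assume j: "j \<in> zp_units p" "j' \<in> zp_units p" "(j - j') / of_nat p ^ (C + m) \<in> zp p"
    define h where "h i = (j powi qexp i - j' powi qexp i) / of_nat p ^ (C + m)" for i
    define H where "H = (\<Sum>i\<in>{1..n}. smult (h i) (D i))"
    have "zp_poly H"
      using D(1) j powi_diff_in_zp by (auto simp: H_def h_def intro!: zp_poly_sum zp_poly_smult)
    moreover have "agrees n (\<lambda>k. adams j k - adams j' k) (smult (of_nat p ^ m) H)"
      unfolding agrees_def
    proof
      fix l assume l: "l \<in> {1..n}"
      have "poly H (qi q l) = (\<Sum>i\<in>{1..n}. if i = l then h i * of_nat p ^ C else 0)"
        unfolding H_def poly_sum using D(2) l by (intro sum.cong) auto
      also have "\<dots> = h l * of_nat p ^ C" using l by simp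
      finally show "adams j (qexp l) - adams j' (qexp l) = poly (smult (of_nat p ^ m) H) (qi q l)"
        using p_pos by (simp add: h_def adams_def power_add)
    qed
    ultimately show "\<exists>H. zp_poly H \<and> agrees n (\<lambda>k. adams j k - adams j' k) (smult (of_nat p ^ m) H)"
      by blast
  qed
qed

lemma adams_Q_power: "adams (Q ^ s) = (\<lambda>k. poly (monom 1 s) (Q powi k))"
  by (simp add: adams_def poly_monom fun_eq_iff flip: power_int_of_nat power_int_mult)
     (simp add: mult.commute)

lemma zp_poly_monom [simp]: "a \<in> zp p \<Longrightarrow> zp_poly (monom a s)"
  by (simp add: zp_poly_def)

text \<open>Approximate \<open>j\<close> by a power of \<open>Q\<close>, whose Adams operation is a
  monomial, and correct the error by the case \<open>m = 0\<close> of
  \<open>adams_diff\<close>.\<close>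

lemma Aset_adams [simp]:
  assumes "j \<in> zp_units p"
  shows "adams j \<in> Aset p q"
  unfolding Aset_iff
proof
  fix n
  obtain C where C: "\<And>j j' m. j \<in> zp_units p \<Longrightarrow> j' \<in> zp_units p \<Longrightarrow>
     (j - j') / of_nat p ^ (C + m) \<in> zp p \<Longrightarrow>
     \<exists>H. zp_poly H \<and> agrees n (\<lambda>k. adams j k - adams j' k) (smult (of_nat p ^ m) H)"
    using adams_diff[where n = n] by blast
  obtain s where s: "(j - Q ^ s) / of_nat p ^ C \<in> zp p" using zp_units_approx[OF assms] .
  obtain H where "zp_poly H" "agrees n (\<lambda>k. adams j k - adams (Q ^ s) k) H"
    using C[of j "Q ^ s" 0] s assms by auto
  thus "\<exists>P. zp_poly P \<and> agrees n (adams j) P"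
    using agrees_add[OF _ agrees_poly[of n "monom 1 s"], of "\<lambda>k. adams j k - adams (Q ^ s) k" H]
    by (intro exI[of _ "H + monom 1 s"]) (auto simp: adams_Q_power)
qed

section \<open>Products over consecutive exponents, and their reduction modulo
  \<open>p\<close>\<close>

definition run_poly :: "int \<Rightarrow> nat \<Rightarrow> rat poly" where
  "run_poly e n = (\<Prod>i<n. [:- (Q powi (e + int i)), 1:])"

lemma zp_poly_run_poly [simp]: "zp_poly (run_poly e n)"
  by (auto simp: run_poly_def zp_units_zp intro!: zp_poly_prod)

lemma run_poly_add: "run_poly e (m + n) = run_poly e m * run_poly (e + int m) n"
  by (induction n) (simp_all add: run_poly_def algebra_simps)

text \<open>The first \<open>2n + 1\<close> exponents of the zigzag enumeration fill the interval
  from \<open>-n\<close> to \<open>n\<close>. Rewritten as an interval, the product can be cut into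
  blocks by \<open>run_poly_add\<close>.\<close>

lemma Theta_poly_run_poly: "Theta_poly (Suc (2 * n)) = run_poly (- int n) (Suc (2 * n))"
proof (induction n)
  case 0
  show ?case by (simp add: Theta_poly_Suc run_poly_def qi_def qexp_def)
next
  case (Suc n)
  have "run_poly (- int (Suc n)) (Suc (2 * Suc n)) =
    run_poly (- int (Suc n)) 1 * (run_poly (- int n) (Suc (2 * n)) * run_poly (int (Suc n)) 1)"
    using run_poly_add[of "- int (Suc n)" 1 "Suc (2 * n) + 1"] run_poly_add[of "- int n" "Suc (2 * n)" 1]
    by (simp add: add.commute)
  also have "run_poly (- int n) (Suc (2 * n)) = Theta_poly (Suc (2 * n))" using Suc by simp
  also have "run_poly (- int (Suc n)) 1 * (Theta_poly (Suc (2 * n)) * run_poly (int (Suc n)) 1)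
     = Theta_poly (Suc (2 * Suc n))"
    using qexp_even[of "Suc n"] qexp_odd[of "Suc n"]
    by (simp add: Theta_poly_Suc run_poly_def qi_def mult_ac)
  finally show ?case by simp
qed

lemma degree_prod_linear: "degree (\<Prod>i<n. [:- f i, 1 :: rat:]) = n"
  by (subst degree_prod_eq_sum_degree) auto

lemma Q_power_totient: "(Q ^ (p ^ k * (p - 1)) - 1) / of_nat p ^ Suc k \<in> zp p"
proof -
  have "int p ^ Suc k > 1" using p_gt_1 by (intro one_less_power) auto
  hence "[q ^ totient (nat (int p ^ Suc k)) = 1] (mod int p ^ Suc k)"
    using coprime_q by (intro residues.euler_theorem) (auto simp: residues_def)
  also have "totient (nat (int p ^ Suc k)) = p ^ k * (p - 1)"
    using totient_prime_power[OF prime_p, of "Suc k"] by (simp add: nat_power_eq nat_mult_distrib)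
  finally obtain e where "q ^ (p ^ k * (p - 1)) - 1 = int p ^ Suc k * e"
    by (auto simp: cong_iff_dvd_diff)
  hence "(of_int (q ^ (p ^ k * (p - 1)) - 1) :: rat) = of_int (int p ^ Suc k * e)" by (simp only:)
  hence "(Q ^ (p ^ k * (p - 1)) - 1) / of_nat p ^ Suc k = of_int e"
    using p_pos by (simp add: field_simps)
  thus ?thesis by simp
qed

text \<open>Both sides are monic of degree \<open>p - 1\<close>, so the difference has smaller
  degree. At the \<open>p - 1\<close> roots of the run, \<open>X^(p-1) - 1\<close> is divisible by
  \<open>p\<close> by Fermat, and these roots are distinct modulo \<open>p\<close>.\<close>

lemma run_poly_modp: "modp_eq (run_poly e (p - 1)) (monom 1 (p - 1) - 1)"
  unfolding modp_eq_def
proof (rule zp_poly_p_multiple[where A = "(\<lambda>i. Q powi (e + int i)) ` {..<p - 1}"])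
  let ?A = "(\<lambda>i. Q powi (e + int i)) ` {..<p - 1}"
  have "inj_on (\<lambda>i. Q powi (e + int i)) {..<p - 1}"
    by (rule inj_onI, drule injD[OF inj_Q_powi], simp)
  hence card: "card ?A = p - 1" by (simp add: card_image)
  have deg: "degree (run_poly e (p - 1)) = p - 1"
    unfolding run_poly_def by (rule degree_prod_linear)
  have lc: "lead_coeff (run_poly e (p - 1)) = 1"
    unfolding run_poly_def by (simp add: lead_coeff_prod)
  have "degree (run_poly e (p - 1) - (monom 1 (p - 1) - 1)) < p - 1"
  proof (rule degree_lessI)
    show "run_poly e (p - 1) - (monom 1 (p - 1) - 1) \<noteq> 0 \<or> 0 < p - 1" using p_ge_3 by simp
    show "\<forall>k\<ge>p - 1. coeff (run_poly e (p - 1) - (monom 1 (p - 1) - 1)) k = 0"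
    proof (intro allI impI)
      fix k assume "k \<ge> p - 1"
      thus "coeff (run_poly e (p - 1) - (monom 1 (p - 1) - 1)) k = 0"
        using lc deg coeff_eq_0[of "run_poly e (p - 1)" k] p_ge_3
        by (cases "k = p - 1") auto
    qed
  qed
  thus "degree (run_poly e (p - 1) - (monom 1 (p - 1) - 1)) < card ?A" by (simp only: card)
  show "?A \<subseteq> zp p" by (auto simp: zp_units_zp)
  show "poly (run_poly e (p - 1) - (monom 1 (p - 1) - 1)) a / of_nat p \<in> zp p" if a: "a \<in> ?A" for a
  proof -
    obtain i where i: "i < p - 1" "a = Q powi (e + int i)" using a by auto
    have "poly (run_poly e (p - 1)) a = 0" using i by (auto simp: run_poly_def poly_prod)
    hence "poly (run_poly e (p - 1) - (monom 1 (p - 1) - 1)) a = - (a ^ (p - 1) - 1)"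
      by (simp add: poly_monom)
    also have "a ^ (p - 1) = (Q ^ (p - 1)) powi (e + int i)"
      unfolding i by (simp add: mult.commute flip: power_int_of_nat power_int_mult)
    finally have "poly (run_poly e (p - 1) - (monom 1 (p - 1) - 1)) a / of_nat p
       = - (((Q ^ (p - 1)) powi (e + int i) - 1 powi (e + int i)) / of_nat p)"
      by (simp only: power_int_1_left minus_divide_left)
    thus ?thesis using powi_diff_in_zp[of "Q ^ (p - 1)" 1 "of_nat p"] Q_power_totient[of 0] by simp
  qed
  show "(a - b) / of_nat p \<notin> zp p" if "a \<in> ?A" "b \<in> ?A" "a \<noteq> b" for a b
  proof -
    obtain i l where il: "i < p - 1" "l < p - 1" "a = Q powi (e + int i)" "b = Q powi (e + int l)"
      using \<open>a \<in> ?A\<close> \<open>b \<in> ?A\<close> by blast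
    moreover have "\<bar>(e + int i) - (e + int l)\<bar> < int p - 1" using il(1,2) by linarith
    moreover have "e + int i \<noteq> e + int l" using il(3,4) \<open>a \<noteq> b\<close> by auto
    ultimately show ?thesis using Q_powi_diff by blast
  qed
qed simp

lemma run_poly_modp_mult: "modp_eq (run_poly e (n * (p - 1))) ((monom 1 (p - 1) - 1) ^ n)"
proof (induction n arbitrary: e)
  case 0
  show ?case by (simp add: run_poly_def)
next
  case (Suc n)
  have "run_poly e (Suc n * (p - 1)) = run_poly e (p - 1) * run_poly (e + int (p - 1)) (n * (p - 1))"
    using run_poly_add[of e "p - 1" "n * (p - 1)"] by simp
  also have "modp_eq \<dots> ((monom 1 (p - 1) - 1) * (monom 1 (p - 1) - 1) ^ n)"
    using Suc run_poly_modp by (intro modp_eq_mult) auto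
  finally show ?case by simp
qed

text \<open>The block consists of \<open>p^k\<close> runs of length \<open>p - 1\<close>, each
  congruent to \<open>X^(p-1) - 1\<close>; the Frobenius identity evaluates the resulting
  power.\<close>

lemma run_poly_block: "modp_eq (run_poly e (p ^ k * (p - 1))) (monom 1 (p ^ k * (p - 1)) - 1)"
proof -
  have "modp_eq (run_poly e (p ^ k * (p - 1))) ((monom 1 (p - 1) - 1) ^ (p ^ k))"
    by (rule run_poly_modp_mult)
  also have "modp_eq \<dots> (monom 1 (p - 1) ^ (p ^ k) - 1)"
    using odd_p by (intro modp_eq_frobenius_power) auto
  also have "monom 1 (p - 1) ^ (p ^ k) = (monom 1 (p ^ k * (p - 1)) :: rat poly)"
    by (simp add: monom_power mult.commute)
  finally show ?thesis .
qed

end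

section \<open>Modules over the p-local integers\<close>

definition poly_act :: "(rat \<Rightarrow> 'm::ab_group_add \<Rightarrow> 'm) \<Rightarrow> ('m \<Rightarrow> 'm) \<Rightarrow> rat poly \<Rightarrow> 'm \<Rightarrow> 'm" where
  "poly_act sc f P x = fold_coeffs (\<lambda>a y. sc a x + f y) P 0"

locale zp_mod = p_local +
  fixes sc :: "rat \<Rightarrow> 'm::ab_group_add \<Rightarrow> 'm"
  assumes zp_mod: "zp_module p sc"
begin

lemma sc_add_right: "c \<in> zp p \<Longrightarrow> sc c (x + y) = sc c x + sc c y"
  and sc_add_left: "c \<in> zp p \<Longrightarrow> d \<in> zp p \<Longrightarrow> sc (c + d) x = sc c x + sc d x"
  and sc_mult: "c \<in> zp p \<Longrightarrow> d \<in> zp p \<Longrightarrow> sc (c * d) x = sc c (sc d x)"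
  and sc_1 [simp]: "sc 1 x = x"
  using zp_mod by (auto simp: zp_module_def)

lemma sc_0_right [simp]: "c \<in> zp p \<Longrightarrow> sc c 0 = 0"
  using sc_add_right[of c 0 0] by simp

lemma sc_0_left [simp]: "sc 0 x = 0"
  using sc_add_left[of 0 0 x] by simp

lemma sc_minus_right: "c \<in> zp p \<Longrightarrow> sc c (- x) = - sc c x"
  using sc_add_right[of c x "- x"] by (simp add: eq_neg_iff_add_eq_0 add.commute)

lemma sc_minus_left: "c \<in> zp p \<Longrightarrow> sc (- c) x = - sc c x"
  using sc_add_left[of c "- c" x] by (simp add: eq_neg_iff_add_eq_0 add.commute)

lemma sc_diff_right: "c \<in> zp p \<Longrightarrow> sc c (x - y) = sc c x - sc c y"
  using sc_add_right[of c x "- y"] by (simp add: sc_minus_right)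

lemma sc_diff_left: "c \<in> zp p \<Longrightarrow> d \<in> zp p \<Longrightarrow> sc (c - d) x = sc c x - sc d x"
  using sc_add_left[of c "- d" x] by (simp add: sc_minus_left)

lemma sc_commute: "c \<in> zp p \<Longrightarrow> d \<in> zp p \<Longrightarrow> sc c (sc d x) = sc d (sc c x)"
  by (metis sc_mult mult.commute)

section \<open>Submodules and spans over \<open>zp p\<close>\<close>

definition submod :: "'m set \<Rightarrow> bool" where
  "submod N \<longleftrightarrow> 0 \<in> N \<and> (\<forall>x\<in>N. \<forall>y\<in>N. x + y \<in> N) \<and> (\<forall>c\<in>zp p. \<forall>x\<in>N. sc c x \<in> N)"

lemma submod_0: "submod N \<Longrightarrow> 0 \<in> N"
  and submod_add: "submod N \<Longrightarrow> x \<in> N \<Longrightarrow> y \<in> N \<Longrightarrow> x + y \<in> N"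
  and submod_sc: "submod N \<Longrightarrow> x \<in> N \<Longrightarrow> c \<in> zp p \<Longrightarrow> sc c x \<in> N"
  by (auto simp: submod_def)

lemma submod_uminus: "submod N \<Longrightarrow> x \<in> N \<Longrightarrow> - x \<in> N"
  using submod_sc[of N x "-1"] sc_minus_left[of 1 x] by simp

lemma submod_diff: "submod N \<Longrightarrow> x \<in> N \<Longrightarrow> y \<in> N \<Longrightarrow> x - y \<in> N"
  using submod_add[of N x "- y"] submod_uminus[of N y] by simp

lemma submod_sum: "submod N \<Longrightarrow> (\<And>i. i \<in> F \<Longrightarrow> g i \<in> N) \<Longrightarrow> sum g F \<in> N"
  by (induction F rule: infinite_finite_induct) (auto simp: submod_0 submod_add)

lemma submod_zspan: "submod (zspan p sc S)"
  unfolding submod_def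
proof (intro conjI ballI)
  show "0 \<in> zspan p sc S"
    unfolding zspan_def by (intro CollectI exI[of _ "{}"]) auto
next
  fix x y assume "x \<in> zspan p sc S" "y \<in> zspan p sc S"
  then obtain F G c d where x: "x = (\<Sum>s\<in>F. sc (c s) s)" "finite F" "F \<subseteq> S" "\<forall>s\<in>F. c s \<in> zp p"
    and y: "y = (\<Sum>s\<in>G. sc (d s) s)" "finite G" "G \<subseteq> S" "\<forall>s\<in>G. d s \<in> zp p"
    unfolding zspan_def by blast
  define c' d' where "c' s = (if s \<in> F then c s else 0)" and "d' s = (if s \<in> G then d s else 0)" for s
  have cd: "c' s \<in> zp p" "d' s \<in> zp p" for s using x y by (auto simp: c'_def d'_def)
  have "x = (\<Sum>s\<in>F \<union> G. sc (c' s) s)"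
    unfolding x(1) using x y by (intro sum.mono_neutral_cong_left) (auto simp: c'_def)
  moreover have "y = (\<Sum>s\<in>F \<union> G. sc (d' s) s)"
    unfolding y(1) using x y by (intro sum.mono_neutral_cong_left) (auto simp: d'_def)
  ultimately have "x + y = (\<Sum>s\<in>F \<union> G. sc (c' s + d' s) s)"
    by (simp add: sc_add_left cd sum.distrib)
  thus "x + y \<in> zspan p sc S"
    unfolding zspan_def using x y cd
    by (intro CollectI exI[of _ "F \<union> G"] exI[of _ "\<lambda>s. c' s + d' s"]) auto
next
  fix c x assume c: "c \<in> zp p" and "x \<in> zspan p sc S"
  then obtain F d where x: "x = (\<Sum>s\<in>F. sc (d s) s)" "finite F" "F \<subseteq> S" "\<forall>s\<in>F. d s \<in> zp p"
    unfolding zspan_def by blast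
  have "sc c (\<Sum>s\<in>F. sc (d s) s) = (\<Sum>s\<in>F. sc (c * d s) s)"
    using x(2,4) by (induction F rule: finite_induct) (auto simp: sc_add_right sc_mult c)
  thus "sc c x \<in> zspan p sc S"
    unfolding zspan_def using x c by (intro CollectI exI[of _ F] exI[of _ "\<lambda>s. c * d s"]) auto
qed

lemma zspan_base: "s \<in> S \<Longrightarrow> s \<in> zspan p sc S"
  unfolding zspan_def by (intro CollectI exI[of _ "{s}"] exI[of _ "\<lambda>_. 1"]) auto

lemma zspan_least: "submod N \<Longrightarrow> S \<subseteq> N \<Longrightarrow> zspan p sc S \<subseteq> N"
  unfolding zspan_def by (auto intro!: submod_sum submod_sc)

lemma zspan_empty: "zspan p sc {} = {0}"
  by (auto simp: zspan_def)

lemma zspan_insertE: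
  assumes "z \<in> zspan p sc (insert s S)"
  obtains c y where "c \<in> zp p" "y \<in> zspan p sc S" "z = sc c s + y"
proof -
  let ?N = "{sc c s + y | c y. c \<in> zp p \<and> y \<in> zspan p sc S}"
  have "submod ?N"
    unfolding submod_def
  proof (intro conjI ballI)
    show "0 \<in> ?N" by (auto intro!: exI[of _ 0] submod_0 submod_zspan)
  next
    fix x y assume "x \<in> ?N" "y \<in> ?N"
    then obtain c u d v where "c \<in> zp p" "d \<in> zp p" "u \<in> zspan p sc S" "v \<in> zspan p sc S"
      "x = sc c s + u" "y = sc d s + v" by blast
    thus "x + y \<in> ?N"
      by (intro CollectI exI[of _ "c + d"] exI[of _ "u + v"])
         (auto simp: sc_add_left submod_add[OF submod_zspan])
  next
    fix c x assume c: "c \<in> zp p" and "x \<in> ?N"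
    then obtain d v where "d \<in> zp p" "v \<in> zspan p sc S" "x = sc d s + v" by blast
    thus "sc c x \<in> ?N" using c
      by (intro CollectI exI[of _ "c * d"] exI[of _ "sc c v"])
         (auto simp: sc_add_right sc_mult submod_sc[OF submod_zspan])
  qed
  moreover have "insert s S \<subseteq> ?N"
  proof
    fix x assume "x \<in> insert s S"
    thus "x \<in> ?N"
    proof
      assume "x = s"
      thus ?thesis by (intro CollectI exI[of _ 1] exI[of _ 0]) (auto intro: submod_0 submod_zspan)
    next
      assume "x \<in> S"
      thus ?thesis by (intro CollectI exI[of _ 0] exI[of _ x]) (auto intro: zspan_base)
    qed
  qed
  ultimately have "z \<in> ?N" using zspan_least assms by blast
  thus ?thesis using that by blast
qed

text \<open>\<open>c\<close> divides some power of \<open>p\<close> in \<open>zp p\<close>, so a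
  nonzero multiple of \<open>s\<close> in \<open>N\<close> can be exchanged for a
  \<open>p\<close>-power multiple.\<close>

lemma p_power_sc_mem:
  assumes "submod N" "sc c s \<in> N" "c \<in> zp p" "c \<noteq> 0"
  obtains t where "sc (of_nat p ^ t) s \<in> N"
proof -
  obtain t where t: "of_nat p ^ t / c \<in> zp p" using p_power_over_in_zp assms(4) by blast
  have "sc (of_nat p ^ t / c) (sc c s) = sc (of_nat p ^ t) s"
    using assms(3,4) t by (simp flip: sc_mult)
  with submod_sc[OF assms(1,2) t] that show ?thesis by simp
qed

lemma p_power_zp [simp]: "of_nat p ^ n \<in> zp p"
  by (intro zp_power zp_of_nat)

text \<open>
  Induction on the generators: either \<open>p\<^sup>t s\<close> lies in the span \<open>N\<close> of the other generators for some
  \<open>t\<close>, so that \<open>p\<^sup>t\<close> maps everything into \<open>N\<close>, or \<open>s\<close> spans a free direct complement of \<open>N\<close>.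
  The torsion bound below uses the same dichotomy.
\<close>

lemma krull_intersection:
  assumes "finite S" "\<And>m. \<exists>z\<in>zspan p sc S. y = sc (of_nat p ^ m) z"
  shows "y = 0"
  using assms
proof (induction S arbitrary: y rule: finite_induct)
  case empty
  thus ?case by (auto simp: zspan_empty)
next
  case (insert s S)
  let ?N = "zspan p sc S"
  show ?case
  proof (cases "\<exists>t. sc (of_nat p ^ t) s \<in> ?N")
    case True
    then obtain t where t: "sc (of_nat p ^ t) s \<in> ?N" by blast
    show ?thesis
    proof (rule insert.IH)
      fix m
      obtain z where z: "z \<in> zspan p sc (insert s S)" "y = sc (of_nat p ^ (m + t)) z"
        using insert.prems by blast
      from z(1) obtain c w where cw: "c \<in> zp p" "w \<in> ?N" "z = sc c s + w" by (rule zspan_insertE)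
      have "y = sc (of_nat p ^ m) (sc c (sc (of_nat p ^ t) s) + sc (of_nat p ^ t) w)"
        using z cw by (simp add: power_add sc_mult sc_add_right sc_commute[of c])
      moreover have "sc c (sc (of_nat p ^ t) s) + sc (of_nat p ^ t) w \<in> ?N"
        using t cw by (auto intro!: submod_add submod_sc submod_zspan)
      ultimately show "\<exists>z\<in>?N. y = sc (of_nat p ^ m) z" by blast
    qed
  next
    case False
    have c0: "c = 0" if "sc c s \<in> ?N" "c \<in> zp p" for c
      using False p_power_sc_mem[OF submod_zspan that] by metis
    obtain a w where aw: "a \<in> zp p" "w \<in> ?N" "y = sc a s + w"
      using insert.prems[of 0] zspan_insertE by (metis power_0 sc_1)
    \<comment> \<open>Comparing components along \<open>s\<close> and in the span of the other
      generators, divisibility of \<open>y\<close> by \<open>p^m\<close> passes to \<open>a\<close>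
      and \<open>w\<close> separately.\<close>
    have *: "a / of_nat p ^ m \<in> zp p \<and> (\<exists>z\<in>?N. w = sc (of_nat p ^ m) z)" for m
    proof -
      obtain z where z: "z \<in> zspan p sc (insert s S)" "y = sc (of_nat p ^ m) z"
        using insert.prems by blast
      then obtain c v where cv: "c \<in> zp p" "v \<in> ?N" "z = sc c s + v" by (metis zspan_insertE)
      have "sc a s + w = sc (of_nat p ^ m * c) s + sc (of_nat p ^ m) v"
        using aw z cv by (simp add: sc_mult sc_add_right)
      hence "sc a s - sc (of_nat p ^ m * c) s = sc (of_nat p ^ m) v - w"
        by (metis add_diff_cancel_left' add_diff_cancel_right' diff_add_eq diff_diff_eq2)
      hence eq: "sc (a - of_nat p ^ m * c) s = sc (of_nat p ^ m) v - w"
        using aw cv by (simp add: sc_diff_left)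
      also have "\<dots> \<in> ?N" using aw cv by (intro submod_diff submod_sc submod_zspan) auto
      finally have a: "a - of_nat p ^ m * c = 0" by (rule c0) (use aw cv in auto)
      with eq have "w = sc (of_nat p ^ m) v" by simp
      moreover have "a / of_nat p ^ m = c" using a p_pos by simp
      ultimately show ?thesis using cv by auto
    qed
    have "w = 0" using * by (intro insert.IH) auto
    moreover have "a = 0" using * by (intro zp_infinitely_divisible) auto
    ultimately show ?thesis using aw by simp
  qed
qed

section \<open>Torsion elements\<close>

abbreviation torsion :: "'m set" where "torsion \<equiv> {z. is_torsion sc z}"

lemma is_torsionI: "sc (of_int n) z = 0 \<Longrightarrow> n \<noteq> 0 \<Longrightarrow> is_torsion sc z"
  by (auto simp: is_torsion_def)

lemma submod_torsion: "submod torsion"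
  unfolding submod_def
proof (intro conjI ballI)
  show "0 \<in> torsion" using is_torsionI[of 1 0] by simp
next
  fix x y assume "x \<in> torsion" "y \<in> torsion"
  then obtain m n where mn: "sc (of_int m) x = 0" "sc (of_int n) y = 0" "m \<noteq> 0" "n \<noteq> 0"
    by (auto simp: is_torsion_def)
  have "sc (of_int (m * n)) (x + y) = sc (of_int n) (sc (of_int m) x) + sc (of_int m) (sc (of_int n) y)"
    by (simp add: sc_mult sc_add_right sc_commute[of "of_int m" "of_int n" x])
  thus "x + y \<in> torsion" using mn is_torsionI[of "m * n"] by simp
next
  fix c x assume c: "c \<in> zp p" and "x \<in> torsion"
  then obtain m where "sc (of_int m) x = 0" "m \<noteq> 0" by (auto simp: is_torsion_def)
  thus "sc c x \<in> torsion" using c is_torsionI[of m] by (simp add: sc_commute[of "of_int m"])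
qed

lemma torsion_if_sc_torsion:
  assumes "is_torsion sc (sc (of_int n) z)" "n \<noteq> 0"
  shows "is_torsion sc z"
proof -
  obtain m where "sc (of_int m) (sc (of_int n) z) = 0" "m \<noteq> 0"
    using assms by (auto simp: is_torsion_def)
  thus ?thesis using assms(2) is_torsionI[of "m * n" z] by (simp add: sc_mult)
qed

lemma bounded_torsion:
  assumes "finite S"
  shows "\<exists>t. \<forall>z\<in>zspan p sc S. is_torsion sc z \<longrightarrow> sc (of_nat p ^ t) z = 0"
  using assms
proof (induction S rule: finite_induct)
  case empty
  show ?case by (auto simp: zspan_empty)
next
  case (insert s S)
  let ?N = "zspan p sc S"
  obtain t where t: "\<And>z. z \<in> ?N \<Longrightarrow> is_torsion sc z \<Longrightarrow> sc (of_nat p ^ t) z = 0"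
    using insert.IH by blast
  show ?case
  proof (cases "\<exists>u. sc (of_nat p ^ u) s \<in> ?N")
    case True
    then obtain u where u: "sc (of_nat p ^ u) s \<in> ?N" by blast
    show ?thesis
    proof (intro exI ballI impI)
      fix z assume z: "z \<in> zspan p sc (insert s S)" "is_torsion sc z"
      from z(1) obtain c w where cw: "c \<in> zp p" "w \<in> ?N" "z = sc c s + w" by (rule zspan_insertE)
      have "sc (of_nat p ^ u) z = sc c (sc (of_nat p ^ u) s) + sc (of_nat p ^ u) w"
        using cw by (simp add: sc_add_right sc_commute[of c])
      also have "\<dots> \<in> ?N" using cw u by (auto intro!: submod_add submod_sc submod_zspan)
      finally have "sc (of_nat p ^ t) (sc (of_nat p ^ u) z) = 0"
        using t z submod_sc[OF submod_torsion, of z] by simp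
      thus "sc (of_nat p ^ (t + u)) z = 0" by (simp add: power_add sc_mult)
    qed
  next
    case False
    have c0: "c = 0" if "sc c s \<in> ?N" "c \<in> zp p" for c
      using False p_power_sc_mem[OF submod_zspan that] by metis
    show ?thesis
    proof (intro exI ballI impI)
      fix z assume z: "z \<in> zspan p sc (insert s S)" "is_torsion sc z"
      from z(1) obtain c w where cw: "c \<in> zp p" "w \<in> ?N" "z = sc c s + w" by (rule zspan_insertE)
      obtain n where n: "sc (of_int n) z = 0" "n \<noteq> 0" using z by (auto simp: is_torsion_def)
      \<comment> \<open>A torsion element has zero component along the free generator
        \<open>s\<close>, so it already lies in the span of the others.\<close>
      have "sc (of_int n * c) s = - sc (of_int n) w"
        using n cw by (simp add: sc_add_right sc_mult eq_neg_iff_add_eq_0)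
      also have "\<dots> \<in> ?N" using cw by (intro submod_uminus submod_sc submod_zspan) auto
      finally have "of_int n * c = 0" by (rule c0) (use cw in auto)
      hence "c = 0" using n by simp
      thus "sc (of_nat p ^ t) z = 0" using t cw z by simp
    qed
  qed
qed

end

section \<open>Polynomials in an endomorphism\<close>

lemma poly_act_0 [simp]: "poly_act sc f 0 x = 0"
  by (simp add: poly_act_def)

locale zp_mod_end = zp_mod p sc
  for p and sc :: "rat \<Rightarrow> 'm::ab_group_add \<Rightarrow> 'm" +
  fixes f :: "'m \<Rightarrow> 'm"
  assumes f_add: "f (x + y) = f x + f y"
    and f_sc: "c \<in> zp p \<Longrightarrow> f (sc c x) = sc c (f x)"
begin

abbreviation pact :: "rat poly \<Rightarrow> 'm \<Rightarrow> 'm" where "pact \<equiv> poly_act sc f"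

lemma f_0 [simp]: "f 0 = 0"
  using f_add[of 0 0] by simp

lemma pact_pCons: "pact (pCons a P) x = sc a x + f (pact P x)"
  by (cases "a = 0 \<and> P = 0") (auto simp: poly_act_def)

lemma pact_add:
  assumes "zp_poly P" "zp_poly R"
  shows "pact (P + R) x = pact P x + pact R x"
  using assms
proof (induction P arbitrary: R rule: zp_poly_induct)
  case (pCons a P)
  obtain b R' where R: "R = pCons b R'" by (cases R)
  have "pact (P + R') x = pact P x + pact R' x" using pCons.IH[of R'] pCons.prems R by simp
  thus ?case using pCons.hyps pCons.prems R by (simp add: pact_pCons sc_add_left f_add add_ac)
qed simp

lemma pact_smult: "zp_poly P \<Longrightarrow> c \<in> zp p \<Longrightarrow> pact (smult c P) x = sc c (pact P x)"
  by (induction P rule: zp_poly_induct) (auto simp: pact_pCons sc_mult f_sc sc_add_right)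

lemma pact_mult:
  assumes "zp_poly P" "zp_poly R"
  shows "pact (P * R) x = pact P (pact R x)"
  using assms
  by (induction P rule: zp_poly_induct) (auto simp: pact_pCons pact_add pact_smult)

lemma pact_const [simp]: "pact [:c:] x = sc c x"
  by (simp add: pact_pCons)

lemma pact_1 [simp]: "pact 1 x = x"
  by (simp add: one_pCons)

lemma pact_diff:
  assumes "zp_poly P" "zp_poly R"
  shows "pact (P - R) x = pact P x - pact R x"
  using pact_add[of "P - R" R x] assms by (simp add: eq_diff_eq)

lemma pact_sum: "(\<And>i. i \<in> F \<Longrightarrow> zp_poly (g i)) \<Longrightarrow> pact (sum g F) x = (\<Sum>i\<in>F. pact (g i) x)"
  by (induction F rule: infinite_finite_induct) (auto simp: pact_add zp_poly_sum)

lemma pact_monom: "pact (monom 1 n) x = (f ^^ n) x"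
  by (induction n) (auto simp: monom_0 monom_Suc pact_pCons)

lemma pact_add_right: "zp_poly P \<Longrightarrow> pact P (x + y) = pact P x + pact P y"
  by (induction P rule: zp_poly_induct) (auto simp: pact_pCons sc_add_right f_add algebra_simps)

lemma pact_0_right [simp]: "zp_poly P \<Longrightarrow> pact P 0 = 0"
  using pact_add_right[of P 0 0] by simp

lemma pact_mem:
  assumes "submod N" "\<And>y. y \<in> N \<Longrightarrow> f y \<in> N" "x \<in> N" "zp_poly P"
  shows "pact P x \<in> N"
  using assms(4) by (induction P rule: zp_poly_induct)
    (use assms in \<open>auto simp: pact_pCons submod_0 intro!: submod_add submod_sc\<close>)

lemma f_torsion: "is_torsion sc z \<Longrightarrow> is_torsion sc (f z)"
  using f_sc[of "of_int n" z for n] by (auto simp: is_torsion_def) (metis f_0 f_sc zp_of_int)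

lemma pact_torsion: "zp_poly P \<Longrightarrow> is_torsion sc z \<Longrightarrow> is_torsion sc (pact P z)"
  using pact_mem[OF submod_torsion] f_torsion by simp

lemma pact_eq_if_kills:
  assumes "pact W x = 0" "zp_poly W" "zp_poly P" "zp_poly P'" "zp_poly R" "P - P' = R * W"
  shows "pact P x = pact P' x"
proof -
  have "pact P x - pact P' x = pact R (pact W x)"
    using assms pact_diff[of P P' x] by (simp add: pact_mult)
  thus ?thesis using assms by simp
qed

end

lemma (in p_local) poly_act_hom:
  assumes "zp_poly P" "\<And>x y. h (x + y) = h x + h y" "\<And>x. h (f x) = f' (h x)"
    and "\<And>c x. c \<in> zp p \<Longrightarrow> h (sc c x) = sc' c (h x)"
    and "zp_mod_end p sc f" "zp_mod_end p sc' f'"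
  shows "h (poly_act sc f P x) = poly_act sc' f' P (h x)"
  using assms(1)
proof (induction P rule: zp_poly_induct)
  case 0
  show ?case using assms(2)[of 0 0] by simp
next
  case (pCons a P)
  thus ?case
    using assms(2-4) by (simp add: zp_mod_end.pact_pCons[OF assms(5)] zp_mod_end.pact_pCons[OF assms(6)])
qed

section \<open>Modules over the group ring and their cyclic submodules\<close>

locale R_mod = p_local +
  fixes sc :: "rat \<Rightarrow> 'm::ab_group_add \<Rightarrow> 'm" and psi :: "rat \<Rightarrow> 'm \<Rightarrow> 'm"
  assumes R_mod: "R_module p sc psi"
begin

sublocale zp_mod p sc
  by unfold_locales (use R_mod in \<open>simp add: R_module_def\<close>)

lemma psi_add: "j \<in> zp_units p \<Longrightarrow> psi j (x + y) = psi j x + psi j y"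
  and psi_sc: "j \<in> zp_units p \<Longrightarrow> c \<in> zp p \<Longrightarrow> psi j (sc c x) = sc c (psi j x)"
  and psi_1 [simp]: "psi 1 x = x"
  and psi_mult: "j \<in> zp_units p \<Longrightarrow> j' \<in> zp_units p \<Longrightarrow> psi (j * j') x = psi j (psi j' x)"
  using R_mod by (auto simp: R_module_def)

lemma zp_mod_end_psi: "j \<in> zp_units p \<Longrightarrow> zp_mod_end p sc (psi j)"
  by unfold_locales (auto simp: psi_add psi_sc)

lemma psi_0: "j \<in> zp_units p \<Longrightarrow> psi j 0 = 0"
  using psi_add[of j 0 0] by simp

lemma psi_power: "j \<in> zp_units p \<Longrightarrow> psi (j ^ n) x = (psi j ^^ n) x"
  by (induction n) (auto simp: psi_mult)

lemma submod_Rsub: "submod (Rsub p sc psi x)"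
  unfolding Rsub_def by (rule submod_zspan)

lemma psi_in_Rsub: "j \<in> zp_units p \<Longrightarrow> psi j x \<in> Rsub p sc psi x"
  unfolding Rsub_def by (auto intro!: zspan_base)

lemma self_in_Rsub: "x \<in> Rsub p sc psi x"
  using psi_in_Rsub[of 1 x] by simp

lemma Rsub_least:
  assumes "submod N" "\<And>j. j \<in> zp_units p \<Longrightarrow> psi j x \<in> N"
  shows "Rsub p sc psi x \<subseteq> N"
  unfolding Rsub_def using assms by (intro zspan_least) auto

lemma psi_Rsub_closed:
  assumes "j \<in> zp_units p" "y \<in> Rsub p sc psi x"
  shows "psi j y \<in> Rsub p sc psi x"
proof -
  let ?N = "{y. psi j y \<in> Rsub p sc psi x}"
  have "submod ?N"
    unfolding submod_def using submod_Rsub[of x] assms(1)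
    by (auto simp: psi_0 psi_add psi_sc submod_0 submod_add submod_sc)
  moreover have "psi j' x \<in> ?N" if "j' \<in> zp_units p" for j'
    using that assms(1) psi_in_Rsub[of "j * j'" x] by (simp add: psi_mult)
  ultimately have "Rsub p sc psi x \<subseteq> ?N" by (rule Rsub_least)
  thus ?thesis using assms(2) by blast
qed

end

section \<open>Discrete modules are Bousfield modules\<close>

locale discrete_module = adams_base p q
  for p q +
  fixes act :: "(int \<Rightarrow> rat) \<Rightarrow> 'm::ab_group_add \<Rightarrow> 'm"
  assumes discrete: "discrete_A_module p q act"
begin

lemma act_add_right: "f \<in> Aset p q \<Longrightarrow> act f (x + y) = act f x + act f y"
  and act_add_left: "f \<in> Aset p q \<Longrightarrow> g \<in> Aset p q \<Longrightarrow> act (\<lambda>k. f k + g k) x = act f x + act g x"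
  and act_mult: "f \<in> Aset p q \<Longrightarrow> g \<in> Aset p q \<Longrightarrow> act (\<lambda>k. f k * g k) x = act f (act g x)"
  and act_1: "act (\<lambda>k. 1) x = x"
  using discrete by (auto simp: discrete_A_module_def A_module_def)

lemma act_kills: "\<exists>n. \<forall>f\<in>Afilt p q n. act f x = 0"
  using discrete by (auto simp: discrete_A_module_def)

lemma act_commute: "f \<in> Aset p q \<Longrightarrow> g \<in> Aset p q \<Longrightarrow> act f (act g x) = act g (act f x)"
  using act_mult[of f g x] act_mult[of g f x] by (simp add: mult.commute)

lemma act_diff_left:
  assumes "f \<in> Aset p q" "g \<in> Aset p q"
  shows "act (\<lambda>k. f k - g k) x = act f x - act g x"
  using act_add_left[OF Aset_diff[OF assms] assms(2), of x] by simp

lemma act_0_right: "f \<in> Aset p q \<Longrightarrow> act f 0 = 0"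
  using act_add_right[of f 0 0] by simp

abbreviation sc :: "rat \<Rightarrow> 'm \<Rightarrow> 'm" where "sc \<equiv> \<lambda>c. act (const_op c)"
abbreviation psi :: "rat \<Rightarrow> 'm \<Rightarrow> 'm" where "psi \<equiv> \<lambda>j. act (adams j)"

lemma R_module_act: "R_module p sc psi"
  unfolding R_module_def zp_module_def
proof (intro conjI ballI allI)
  fix c d x assume cd: "c \<in> zp p" "d \<in> zp p"
  hence "const_op c \<in> Aset p q" "const_op d \<in> Aset p q" by auto
  thus "sc (c + d) x = sc c x + sc d x" "sc (c * d) x = sc c (sc d x)"
    using act_add_left[of "const_op c" "const_op d" x] act_mult[of "const_op c" "const_op d" x]
    by (simp_all add: const_op_def)
next
  fix x show "sc 1 x = x" "psi 1 x = x"
    using act_1[of x] by (simp_all add: const_op_def adams_def)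
next
  fix j j' x assume "j \<in> zp_units p" "j' \<in> zp_units p"
  hence "adams j \<in> Aset p q" "adams j' \<in> Aset p q" by auto
  thus "psi (j * j') x = psi j (psi j' x)"
    using act_mult[of "adams j" "adams j'" x] by (simp add: adams_def power_int_mult_distrib)
qed (auto intro: act_add_right act_commute)

sublocale R_mod p sc psi
  by unfold_locales (rule R_module_act)

sublocale zp_mod_end p sc "psi Q"
  by (rule zp_mod_end_psi) simp

lemma act_poly: "zp_poly P \<Longrightarrow> act (\<lambda>k. poly P (Q powi k)) x = pact P x"
proof (induction P rule: zp_poly_induct)
  case 0
  show ?case using sc_0_left[of x] by (simp add: const_op_def)
next
  case (pCons a P)
  have "act (\<lambda>k. const_op a k + adams Q k * poly P (Q powi k)) x
      = sc a x + act (\<lambda>k. adams Q k * poly P (Q powi k)) x"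
    using pCons by (intro act_add_left Aset_mult) auto
  also have "act (\<lambda>k. adams Q k * poly P (Q powi k)) x = psi Q (act (\<lambda>k. poly P (Q powi k)) x)"
    using pCons by (intro act_mult) auto
  also have "(\<lambda>k. const_op a k + adams Q k * poly P (Q powi k)) = (\<lambda>k. poly (pCons a P) (Q powi k))"
    by (simp add: const_op_def adams_def)
  finally show ?case using pCons.IH by (simp only: pact_pCons)
qed

text \<open>The difference between \<open>f\<close> and the polynomial lies in
  \<open>Afilt p q n\<close>. This is how discreteness reduces the action of \<open>A\<close> at
  \<open>x\<close> to polynomials in the Adams operation of \<open>q\<close>.\<close>

lemma act_eq_pact:
  assumes "f \<in> Aset p q" "zp_poly P" "agrees n f P" "\<forall>g\<in>Afilt p q n. act g x = 0"
  shows "act f x = pact P x"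
proof -
  have "(\<lambda>k. f k - poly P (Q powi k)) \<in> Afilt p q n"
    using assms Aset_diff[of f "\<lambda>k. poly P (Q powi k)"] agrees_poly[of n P]
    by (auto simp: Afilt_iff agrees_def)
  hence "act (\<lambda>k. f k - poly P (Q powi k)) x = 0" using assms(4) by blast
  thus ?thesis using assms act_poly[of P x] by (simp add: act_diff_left)
qed

text \<open>\<open>A\<close> is commutative, so the elements killed by a fixed operation form a
  submodule stable under all Adams operations; one \<open>n\<close> serves for all of
  \<open>R x\<close>.\<close>

lemma Afilt_kills_Rsub:
  assumes "\<forall>g\<in>Afilt p q n. act g x = 0" "y \<in> Rsub p sc psi x"
  shows "\<forall>g\<in>Afilt p q n. act g y = 0"
proof
  fix g assume g: "g \<in> Afilt p q n"
  hence gA: "g \<in> Aset p q" using Afilt_subset_Aset by blast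
  let ?N = "{y. act g y = 0}"
  have "submod ?N"
    unfolding submod_def using gA
    by (auto simp: act_0_right act_add_right act_commute[OF gA Aset_const])
  moreover have "psi j x \<in> ?N" if "j \<in> zp_units p" for j
    using that gA g assms(1) by (auto simp: act_commute[OF gA Aset_adams] act_0_right)
  ultimately have "Rsub p sc psi x \<subseteq> ?N" by (rule Rsub_least)
  thus "act g y = 0" using assms(2) by blast
qed

lemma pact_Rsub: "zp_poly P \<Longrightarrow> y \<in> Rsub p sc psi x \<Longrightarrow> pact P y \<in> Rsub p sc psi x"
  by (rule pact_mem[OF submod_Rsub]) (auto intro: psi_Rsub_closed)

text \<open>Newton expansion of each Adams operation, cut off at the \<open>n\<close> for which
  \<open>Afilt p q n\<close> kills \<open>x\<close>, shows that \<open>Theta_poly m\<close> applied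
  to \<open>x\<close> for \<open>m < n\<close> generates \<open>R x\<close>.\<close>

lemma Rsub_finitely_generated: "\<exists>S. finite S \<and> zspan p sc S = Rsub p sc psi x"
proof -
  obtain n where n: "\<forall>g\<in>Afilt p q n. act g x = 0" using act_kills by blast
  let ?S = "(\<lambda>m. pact (Theta_poly m) x) ` {..<n}"
  have "zspan p sc ?S \<subseteq> Rsub p sc psi x"
    by (rule zspan_least[OF submod_Rsub]) (auto intro: pact_Rsub self_in_Rsub)
  moreover have "Rsub p sc psi x \<subseteq> zspan p sc ?S"
  proof (rule Rsub_least[OF submod_zspan])
    fix j assume j: "j \<in> zp_units p"
    obtain a where a: "adams j = A_elem q a" "\<And>m. a m \<in> zp p"
      using Aset_adams[OF j] by (auto simp: Aset_def)
    have "agrees n (adams j) (\<Sum>m<n. smult (a m) (Theta_poly m))"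
      using A_elem_qexp[of _ n a] a by (simp add: agrees_def poly_sum)
    hence "psi j x = pact (\<Sum>m<n. smult (a m) (Theta_poly m)) x"
      using j a(2) n by (intro act_eq_pact) (auto intro!: zp_poly_sum)
    also have "\<dots> = (\<Sum>m<n. sc (a m) (pact (Theta_poly m) x))"
      using a by (simp add: pact_sum pact_smult)
    also have "\<dots> \<in> zspan p sc ?S"
      using a by (intro submod_sum submod_sc submod_zspan zspan_base) auto
    finally show "psi j x \<in> zspan p sc ?S" .
  qed
  ultimately have "zspan p sc ?S = Rsub p sc psi x" by blast
  thus ?thesis by (intro exI[of _ ?S]) auto
qed

text \<open>The polynomials \<open>D i\<close> act as \<open>p^C\<close> times the projections to
  the weights. Both required relations then hold exactly, so the torsion terms are
  \<open>0\<close>.\<close>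

lemma Rsub_diagonalisable:
  assumes "j \<in> zp_units p" "y \<in> Rsub p sc psi x"
  shows "\<exists>d::int. d \<noteq> 0 \<and> (\<exists>(F::nat set) ys ks. finite F \<and>
    (\<forall>i\<in>F. ys i \<in> Rsub p sc psi x \<and> is_torsion sc (psi j (ys i) - sc (j powi ks i) (ys i))) \<and>
    is_torsion sc (sc (of_int d) y - (\<Sum>i\<in>F. ys i)))"
proof -
  obtain n where "\<forall>g\<in>Afilt p q n. act g x = 0" using act_kills by blast
  hence n: "\<forall>g\<in>Afilt p q n. act g y = 0" using Afilt_kills_Rsub assms(2) by blast
  obtain C D where D: "\<And>i. i \<in> {1..n} \<Longrightarrow> zp_poly (D i)"
    "\<And>i l. i \<in> {1..n} \<Longrightarrow> l \<in> {1..n} \<Longrightarrow>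
       poly (D i) (qi q l) = (if i = l then of_nat p ^ C else 0)"
    using delta_polys[where n = n] by metis
  have eigen: "psi j (pact (D i) y) = sc (j powi qexp i) (pact (D i) y)" if i: "i \<in> {1..n}" for i
  proof -
    have "psi j (pact (D i) y) = act (\<lambda>k. adams j k * poly (D i) (Q powi k)) y"
      using D(1)[OF i] assms(1) by (simp add: act_mult flip: act_poly)
    also have "\<dots> = pact (smult (j powi qexp i) (D i)) y"
    proof (rule act_eq_pact[OF _ _ _ n])
      show "agrees n (\<lambda>k. adams j k * poly (D i) (Q powi k)) (smult (j powi qexp i) (D i))"
        using D(2)[OF i] by (auto simp: agrees_def adams_def simp flip: qi_def)
    qed (use D(1)[OF i] assms(1) in \<open>auto intro!: Aset_mult zp_poly_smult simp: zp_units_zp\<close>)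
    also have "\<dots> = sc (j powi qexp i) (pact (D i) y)"
      using D(1)[OF i] assms(1) by (intro pact_smult) (auto simp: zp_units_zp)
    finally show ?thesis .
  qed
  have "agrees n (const_op (of_nat p ^ C)) (\<Sum>i\<in>{1..n}. D i)"
    using D(2) by (auto simp: agrees_def const_op_def poly_sum)
  hence "sc (of_nat p ^ C) y = pact (\<Sum>i\<in>{1..n}. D i) y"
    using D(1) n by (intro act_eq_pact[where n = n] zp_poly_sum) auto
  also have "\<dots> = (\<Sum>i\<in>{1..n}. pact (D i) y)" using D(1) by (intro pact_sum)
  finally have sum: "sc (of_int (int p ^ C)) y = (\<Sum>i\<in>{1..n}. pact (D i) y)" by simp
  have tors_0: "is_torsion sc 0" using submod_0[OF submod_torsion] by simp
  show ?thesis
    using eigen sum p_pos tors_0 D(1) assms(2) pact_Rsub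
    by (intro exI[of _ "int p ^ C"] conjI exI[of _ "{1..n}"] exI[of _ "\<lambda>i. pact (D i) y"]
        exI[of _ qexp]) auto
qed

lemma Rsub_adic_continuous:
  "\<exists>k::nat. \<forall>j\<in>zp_units p. \<forall>j'\<in>zp_units p. (j - j') / of_nat (p ^ k) \<in> zp p \<longrightarrow>
     (\<forall>y\<in>Rsub p sc psi x. psi j y - psi j' y \<in> {sc (of_nat (p ^ m)) z | z. z \<in> Rsub p sc psi x})"
proof -
  obtain n where n: "\<forall>g\<in>Afilt p q n. act g x = 0" using act_kills by blast
  obtain C where C: "\<And>j j' m. j \<in> zp_units p \<Longrightarrow> j' \<in> zp_units p \<Longrightarrow>
     (j - j') / of_nat p ^ (C + m) \<in> zp p \<Longrightarrow>
     \<exists>H. zp_poly H \<and> agrees n (\<lambda>k. adams j k - adams j' k) (smult (of_nat p ^ m) H)"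
    using adams_diff[where n = n] by blast
  show ?thesis
  proof (intro exI[of _ "C + m"] ballI impI)
    fix j j' y
    assume j: "j \<in> zp_units p" "j' \<in> zp_units p" "(j - j') / of_nat (p ^ (C + m)) \<in> zp p"
      and y: "y \<in> Rsub p sc psi x"
    obtain H where H: "zp_poly H" "agrees n (\<lambda>k. adams j k - adams j' k) (smult (of_nat p ^ m) H)"
      using C[of j j' m] j by auto
    have "psi j y - psi j' y = act (\<lambda>k. adams j k - adams j' k) y"
      using j by (simp add: act_diff_left)
    also have "\<dots> = pact (smult (of_nat p ^ m) H) y"
      using H j Afilt_kills_Rsub[OF n y] by (intro act_eq_pact Aset_diff) auto
    also have "\<dots> = sc (of_nat (p ^ m)) (pact H y)" using H(1) by (simp add: pact_smult)
    finally show "psi j y - psi j' y \<in> {sc (of_nat (p ^ m)) z | z. z \<in> Rsub p sc psi x}"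
      using pact_Rsub[OF H(1) y] by blast
  qed
qed

lemma bousfield_module_act: "bousfield_module p sc psi"
  unfolding bousfield_module_def
  by (intro conjI allI impI ballI R_module_act Rsub_finitely_generated Rsub_diagonalisable
      Rsub_adic_continuous)

end

text \<open>One polynomial represents \<open>f\<close> both at \<open>x\<close> and at
  \<open>h x\<close>, once enough weights are matched for the two elements; \<open>h\<close>
  commutes with scalars and the Adams operation of \<open>q\<close>, hence with that
  polynomial.\<close>

lemma (in adams_base) R_hom_imp_A_hom:
  fixes h :: "'m::ab_group_add \<Rightarrow> 'n::ab_group_add"
  assumes "discrete_A_module p q act" "discrete_A_module p q act'"
    and "extends_R p sc psi act" "extends_R p sc' psi' act'"
    and "R_hom p sc psi sc' psi' h"
  shows "A_hom p q act act' h"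
proof -
  interpret M: discrete_module p q act by unfold_locales fact
  interpret N: discrete_module p q act' by unfold_locales fact
  have h: "h (x + y) = h x + h y" "c \<in> zp p \<Longrightarrow> h (M.sc c x) = N.sc c (h x)"
    "h (M.psi Q x) = N.psi Q (h x)" for c x y
    using assms(3-5) by (auto simp: extends_R_def R_hom_def)
  have "h (act f x) = act' f (h x)" if f: "f \<in> Aset p q" for f x
  proof -
    obtain m n where mn: "\<forall>g\<in>Afilt p q m. act g x = 0" "\<forall>g\<in>Afilt p q n. act' g (h x) = 0"
      using M.act_kills[of x] N.act_kills[of "h x"] by blast
    obtain P where P: "zp_poly P" "agrees (max m n) f P" using f Aset_iff by blast
    have "act f x = M.pact P x"
      using P f mn by (intro M.act_eq_pact[of f P m]) (auto intro: agrees_mono)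
    moreover have "act' f (h x) = N.pact P (h x)"
      using P f mn by (intro N.act_eq_pact[of f P n]) (auto intro: agrees_mono)
    moreover have "h (M.pact P x) = N.pact P (h x)"
      using P(1) h M.zp_mod_end_axioms N.zp_mod_end_axioms by (intro poly_act_hom) auto
    ultimately show ?thesis by simp
  qed
  thus ?thesis using h(1) by (auto simp: A_hom_def)
qed

section \<open>Bousfield modules are discrete modules\<close>

locale bousfield = adams_base p q
  for p q +
  fixes sc :: "rat \<Rightarrow> 'm::ab_group_add \<Rightarrow> 'm" and psi :: "rat \<Rightarrow> 'm \<Rightarrow> 'm"
  assumes bousfield: "bousfield_module p sc psi"
begin

sublocale R_mod p sc psi
  by unfold_locales (use bousfield in \<open>simp add: bousfield_module_def\<close>)

sublocale zp_mod_end p sc "psi Q"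
  by (rule zp_mod_end_psi) simp

lemma Rsub_finitely_generated: "\<exists>S. finite S \<and> zspan p sc S = Rsub p sc psi x"
  using bousfield by (simp add: bousfield_module_def)

lemma Rsub_eigen_decomposition:
  obtains d :: int and F :: "nat set" and ys ks where "d \<noteq> 0" "finite F"
    "\<And>i. i \<in> F \<Longrightarrow> is_torsion sc (psi Q (ys i) - sc (Q powi ks i) (ys i))"
    "is_torsion sc (sc (of_int d) x - (\<Sum>i\<in>F. ys i))"
proof -
  have "\<exists>d::int. d \<noteq> 0 \<and> (\<exists>(F::nat set) ys ks. finite F \<and>
      (\<forall>i\<in>F. ys i \<in> Rsub p sc psi x \<and> is_torsion sc (psi Q (ys i) - sc (Q powi ks i) (ys i))) \<and>
      is_torsion sc (sc (of_int d) x - (\<Sum>i\<in>F. ys i)))"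
    using bousfield self_in_Rsub[of x] Q_unit unfolding bousfield_module_def by blast
  thus ?thesis using that by blast
qed

lemma Rsub_adic_continuous:
  assumes "m \<ge> 1"
  obtains k where "\<And>j j' y. j \<in> zp_units p \<Longrightarrow> j' \<in> zp_units p \<Longrightarrow>
    (j - j') / of_nat p ^ k \<in> zp p \<Longrightarrow> y \<in> Rsub p sc psi x \<Longrightarrow>
    \<exists>z\<in>Rsub p sc psi x. psi j y - psi j' y = sc (of_nat p ^ m) z"
proof -
  obtain k where k: "\<forall>j\<in>zp_units p. \<forall>j'\<in>zp_units p. (j - j') / of_nat (p ^ k) \<in> zp p \<longrightarrow>
     (\<forall>y\<in>Rsub p sc psi x. psi j y - psi j' y \<in> {sc (of_nat (p ^ m)) z | z. z \<in> Rsub p sc psi x})"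
    using bousfield assms unfolding bousfield_module_def by blast
  show ?thesis
  proof (rule that[of k])
    fix j j' y
    assume "j \<in> zp_units p" "j' \<in> zp_units p" "(j - j') / of_nat p ^ k \<in> zp p" "y \<in> Rsub p sc psi x"
    with k[rule_format, of j j' y]
    show "\<exists>z\<in>Rsub p sc psi x. psi j y - psi j' y = sc (of_nat p ^ m) z" by auto
  qed
qed

lemma pact_Rsub: "zp_poly P \<Longrightarrow> y \<in> Rsub p sc psi x \<Longrightarrow> pact P y \<in> Rsub p sc psi x"
  by (rule pact_mem[OF submod_Rsub]) (auto intro: psi_Rsub_closed)

text \<open>For \<open>n\<close> bounding all exponents \<open>ks i\<close>, the product contains a
  factor \<open>X - Q^(ks i)\<close> for each eigenvector and so sends it to torsion. A nonzero
  multiple of \<open>x\<close> is, up to torsion, the sum of these eigenvectors.\<close>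

lemma Theta_poly_torsion: "\<exists>n. is_torsion sc (pact (Theta_poly (Suc (2 * n))) x)"
proof -
  obtain d :: int and F :: "nat set" and ys ks where
    d: "d \<noteq> 0" "is_torsion sc (sc (of_int d) x - (\<Sum>i\<in>F. ys i))" and F: "finite F"
    "\<And>i. i \<in> F \<Longrightarrow> is_torsion sc (psi Q (ys i) - sc (Q powi ks i) (ys i))"
    using Rsub_eigen_decomposition[of x] by metis
  define n where "n = (\<Sum>i\<in>F. nat \<bar>ks i\<bar>)"
  define W where "W = Theta_poly (Suc (2 * n))"
  have W: "zp_poly W" by (simp add: W_def)
  have "is_torsion sc (pact W (ys i))" if i: "i \<in> F" for i
  proof -
    have "nat \<bar>ks i\<bar> \<le> n" unfolding n_def using F i by (intro member_le_sum) auto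
    \<comment> \<open>\<open>nat (ks i + int n)\<close> is the position of the exponent
      \<open>ks i\<close> in the run starting at \<open>-n\<close>.\<close>
    hence "nat (ks i + int n) < Suc (2 * n)" "- int n + int (nat (ks i + int n)) = ks i" by auto
    hence "W = (\<Prod>l\<in>{..<Suc (2 * n)} - {nat (ks i + int n)}. [:- (Q powi (- int n + int l)), 1:])
        * [:- (Q powi ks i), 1:]" (is "W = ?R * _")
      unfolding W_def Theta_poly_run_poly run_poly_def
      by (subst prod.remove[of _ "nat (ks i + int n)"]) (auto simp: mult.commute)
    moreover have R: "zp_poly ?R" by (intro zp_poly_prod) (auto simp: zp_units_zp)
    ultimately have "pact W (ys i) = pact ?R (psi Q (ys i) - sc (Q powi ks i) (ys i))"
      by (simp add: pact_mult pact_pCons zp_units_zp sc_minus_left del: mult_pCons_right)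
    thus ?thesis using pact_torsion[OF R] F(2)[OF i] by simp
  qed
  hence "(\<Sum>i\<in>F. pact W (ys i)) \<in> torsion" by (intro submod_sum[OF submod_torsion]) auto
  also have "(\<Sum>i\<in>F. pact W (ys i)) = pact W (\<Sum>i\<in>F. ys i)"
    using F(1) W by (induction F rule: finite_induct) (auto simp: pact_add_right)
  finally have "pact W (\<Sum>i\<in>F. ys i) + pact W (sc (of_int d) x - (\<Sum>i\<in>F. ys i)) \<in> torsion"
    using pact_torsion[OF W d(2)] by (intro submod_add[OF submod_torsion]) auto
  hence "is_torsion sc (pact W (sc (of_int d) x))" using W by (simp flip: pact_add_right)
  also have "pact W (sc (of_int d) x) = pact (W * [:of_int d:]) x"
    using W by (subst pact_mult) auto
  also have "\<dots> = sc (of_int d) (pact W x)" using W by (simp add: pact_smult)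
  finally show ?thesis using torsion_if_sc_torsion d(1) unfolding W_def by blast
qed

text \<open>A block of \<open>s\<close> consecutive exponents is \<open>X^s - 1\<close> modulo
  \<open>p\<close>, and \<open>X^s - 1\<close> vanishes on the torsion \<open>?T\<close>, so each
  block maps \<open>?T\<close> into \<open>p\<close> times \<open>?T\<close>. The length
  \<open>L\<close> does not depend on where the run starts.\<close>

lemma run_poly_kills_torsion:
  obtains L where "\<And>e z. z \<in> Rsub p sc psi x \<Longrightarrow> is_torsion sc z \<Longrightarrow> pact (run_poly e L) z = 0"
proof -
  let ?T = "{z \<in> Rsub p sc psi x. is_torsion sc z}"
  obtain S where S: "finite S" "zspan p sc S = Rsub p sc psi x"
    using Rsub_finitely_generated by blast
  obtain t0 where t0: "\<forall>z\<in>Rsub p sc psi x. is_torsion sc z \<longrightarrow> sc (of_nat p ^ t0) z = 0"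
    using bounded_torsion[OF S(1)] S(2) by metis
  \<comment> \<open>Condition (c) is available only for exponents at least \<open>1\<close>.\<close>
  define t where "t = Suc t0"
  have t: "sc (of_nat p ^ t) z = 0" if "z \<in> ?T" for z
    using t0 that unfolding t_def power_Suc by (subst sc_mult) auto
  have "t \<ge> 1" by (simp add: t_def)
  then obtain k where k: "\<And>j j' y. j \<in> zp_units p \<Longrightarrow> j' \<in> zp_units p \<Longrightarrow>
    (j - j') / of_nat p ^ k \<in> zp p \<Longrightarrow> y \<in> Rsub p sc psi x \<Longrightarrow>
    \<exists>z\<in>Rsub p sc psi x. psi j y - psi j' y = sc (of_nat p ^ t) z"
    using Rsub_adic_continuous[of t x] by metis
  define s where "s = p ^ k * (p - 1)"
  \<comment> \<open>By (c) the difference is \<open>p^t * z\<close> with \<open>z\<close> in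
    \<open>R x\<close>. It is torsion, hence so is \<open>z\<close>, and \<open>p^t\<close> kills
    \<open>z\<close>.\<close>
  have psi_s: "(psi Q ^^ s) y = y" if y: "y \<in> ?T" for y
  proof -
    have "(Q ^ s - 1) / of_nat p ^ k \<in> zp p"
      unfolding s_def using zp_divide_power_mono[OF Q_power_totient[of k]] by simp
    then obtain z where z: "z \<in> Rsub p sc psi x" "psi (Q ^ s) y - psi 1 y = sc (of_nat p ^ t) z"
      using k[of "Q ^ s" 1 y] y by auto
    have "psi (Q ^ s) y - psi 1 y \<in> torsion"
      using y pact_torsion[of "monom 1 s" y]
      by (intro submod_diff[OF submod_torsion]) (auto simp: pact_monom psi_power)
    hence "is_torsion sc (sc (of_int (int p ^ t)) z)" unfolding z(2) by simp
    hence "is_torsion sc z" by (rule torsion_if_sc_torsion) (use p_pos in simp)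
    with t z have "psi (Q ^ s) y - psi 1 y = 0" by simp
    thus ?thesis by (simp add: psi_power)
  qed
  have block: "\<exists>y'\<in>?T. pact (run_poly e s) y = sc (of_nat p) y'" if y: "y \<in> ?T" for e y
  proof -
    obtain G where G: "zp_poly G" "run_poly e s = (monom 1 s - 1) + smult (of_nat p) G"
      using run_poly_block[of e k] unfolding modp_eq_iff s_def by blast
    have "pact (run_poly e s) y = sc (of_nat p) (pact G y)"
      unfolding G(2) using G(1) psi_s[OF y]
      by (simp add: pact_add pact_diff pact_smult pact_monom)
    thus ?thesis using y G(1) pact_Rsub pact_torsion by (intro bexI[of _ "pact G y"]) auto
  qed
  have blocks: "\<exists>y'\<in>?T. pact (run_poly e (n * s)) y = sc (of_nat p ^ n) y'" if "y \<in> ?T" for e y n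
    using that
  proof (induction n arbitrary: y)
    case 0
    thus ?case by (auto simp: run_poly_def)
  next
    case (Suc n)
    obtain y' where y': "y' \<in> ?T" "pact (run_poly (e + int (n * s)) s) y = sc (of_nat p) y'"
      using block Suc.prems by blast
    obtain y'' where y'': "y'' \<in> ?T" "pact (run_poly e (n * s)) y' = sc (of_nat p ^ n) y''"
      using Suc.IH y'(1) by blast
    have "pact (run_poly e (n * s)) (sc (of_nat p) y') = sc (of_nat p) (sc (of_nat p ^ n) y'')"
      using y'' pact_mult[of "run_poly e (n * s)" "[:of_nat p:]" y']
        pact_mult[of "[:of_nat p:]" "run_poly e (n * s)" y'] by (simp add: mult.commute)
    hence "pact (run_poly e (Suc n * s)) y = sc (of_nat p ^ Suc n) y''"
      using y' run_poly_add[of e "n * s" s] by (simp add: pact_mult sc_mult add.commute)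
    thus ?case using y'' by blast
  qed
  show ?thesis
  proof (rule that[of "t * s"])
    fix e z assume "z \<in> Rsub p sc psi x" "is_torsion sc z"
    thus "pact (run_poly e (t * s)) z = 0" using blocks[of z e t] t by auto
  qed
qed

text \<open>Enlarge the interval of exponents by \<open>L\<close> at both ends: the middle part
  makes \<open>x\<close> torsion, the upper run of length \<open>L\<close> kills the result, and the
  lower run acts on \<open>0\<close>.\<close>

theorem Theta_poly_kills: "\<exists>n. pact (Theta_poly n) x = 0"
proof -
  obtain n where n: "is_torsion sc (pact (Theta_poly (Suc (2 * n))) x)"
    using Theta_poly_torsion by blast
  obtain L where L: "\<And>e z. z \<in> Rsub p sc psi x \<Longrightarrow> is_torsion sc z \<Longrightarrow> pact (run_poly e L) z = 0"
    using run_poly_kills_torsion[where x = x] by metis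
  have "run_poly (- int (n + L)) (Suc (2 * (n + L)))
      = run_poly (- int (n + L)) L * (run_poly (- int n) (Suc (2 * n)) * run_poly (int n + 1) L)"
    using run_poly_add[of "- int (n + L)" L "Suc (2 * n) + L"] run_poly_add[of "- int n" "Suc (2 * n)" L]
    by (simp add: algebra_simps)
  hence "Theta_poly (Suc (2 * (n + L)))
      = (run_poly (- int (n + L)) L * run_poly (int n + 1) L) * Theta_poly (Suc (2 * n))"
    unfolding Theta_poly_run_poly by (simp only: mult_ac)
  hence "pact (Theta_poly (Suc (2 * (n + L)))) x = 
      pact (run_poly (- int (n + L)) L) (pact (run_poly (int n + 1) L) (pact (Theta_poly (Suc (2 * n))) x))"
    by (simp only: pact_mult zp_poly_mult zp_poly_run_poly zp_poly_Theta_poly)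
  also have "pact (run_poly (int n + 1) L) (pact (Theta_poly (Suc (2 * n))) x) = 0"
    using n by (intro L pact_Rsub self_in_Rsub) auto
  finally show ?thesis by (intro exI[of _ "Suc (2 * (n + L))"]) simp
qed

lemma Theta_poly_kills_mono:
  assumes "pact (Theta_poly m) x = 0" "m \<le> n"
  shows "pact (Theta_poly n) x = 0"
proof -
  obtain R where "zp_poly R" "Theta_poly n = R * Theta_poly m" using Theta_poly_dvd assms(2) by blast
  thus ?thesis using assms(1) by (simp add: pact_mult)
qed

section \<open>Construction of the action of \<open>A\<close> on a Bousfield module\<close>

lemma pact_eq_if_agrees:
  assumes "zp_poly P" "zp_poly P'" "agrees n f P" "agrees n f P'" "pact (Theta_poly n) x = 0"
  shows "pact P x = pact P' x"
proof -
  have "zp_poly (P - P')" "\<And>i. i \<in> {1..n} \<Longrightarrow> poly (P - P') (qi q i) = 0"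
    using assms by (auto simp: agrees_def)
  then obtain R where "zp_poly R" "P - P' = R * Theta_poly n" by (rule Theta_poly_factor)
  thus ?thesis using assms by (intro pact_eq_if_kills[of "Theta_poly n"]) auto
qed

text \<open>The two choices do not affect the value for \<open>f\<close> in \<open>A\<close>, as
  \<open>act_eq_pact\<close> shows; outside \<open>A\<close> the value is arbitrary.\<close>

definition act :: "(int \<Rightarrow> rat) \<Rightarrow> 'm \<Rightarrow> 'm" where
  "act f x = pact (SOME P. zp_poly P \<and> agrees (SOME n. pact (Theta_poly n) x = 0) f P) x"

lemma act_eq_pact:
  assumes "f \<in> Aset p q" "zp_poly P" "agrees n f P" "pact (Theta_poly n) x = 0"
  shows "act f x = pact P x"
proof -
  define m where "m = (SOME n. pact (Theta_poly n) x = 0)"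
  have m: "pact (Theta_poly m) x = 0" unfolding m_def using Theta_poly_kills by (rule someI_ex)
  define P' where "P' = (SOME P. zp_poly P \<and> agrees m f P)"
  have "\<exists>P. zp_poly P \<and> agrees m f P" using assms(1) unfolding Aset_iff by (rule spec)
  hence "zp_poly P' \<and> agrees m f P'" unfolding P'_def by (rule someI_ex)
  \<comment> \<open>The minimum is \<open>m\<close> or \<open>n\<close>, so its polynomial kills
    \<open>x\<close>, and both agreements restrict to it.\<close>
  moreover have "pact (Theta_poly (min m n)) x = 0" using m assms(4) by (simp add: min_def)
  ultimately have "pact P' x = pact P x"
    using assms by (intro pact_eq_if_agrees[of _ _ "min m n" f]) (auto intro: agrees_mono)
  thus ?thesis by (simp add: act_def P'_def m_def)
qed

lemma common_kill:
  obtains n where "pact (Theta_poly n) x = 0" "pact (Theta_poly n) y = 0"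
proof -
  obtain m n where "pact (Theta_poly m) x = 0" "pact (Theta_poly n) y = 0"
    using Theta_poly_kills by blast
  thus ?thesis
    by (intro that[of "max m n"]) (rule Theta_poly_kills_mono, assumption, simp)+
qed

lemma A_module_act: "A_module p q act"
  unfolding A_module_def
proof (intro conjI ballI allI)
  fix f x y assume f: "f \<in> Aset p q"
  obtain n where n: "pact (Theta_poly n) x = 0" "pact (Theta_poly n) y = 0" by (rule common_kill)
  obtain P where P: "zp_poly P" "agrees n f P" using f Aset_iff by blast
  have "pact (Theta_poly n) (x + y) = 0" using n by (simp add: pact_add_right)
  thus "act f (x + y) = act f x + act f y"
    using f P n by (simp add: act_eq_pact[of f P n] pact_add_right)
next
  fix f g x assume fg: "f \<in> Aset p q" "g \<in> Aset p q"
  \<comment> \<open>The product law needs a polynomial that represents \<open>f\<close> at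
    \<open>act g x\<close> as well as at \<open>x\<close>.\<close>
  obtain n where n: "pact (Theta_poly n) x = 0" "pact (Theta_poly n) (act g x) = 0" by (rule common_kill)
  obtain P R where P: "zp_poly P" "agrees n f P" and R: "zp_poly R" "agrees n g R"
    using fg Aset_iff by meson
  show "act (\<lambda>k. f k + g k) x = act f x + act g x"
    using fg P R n(1) act_eq_pact[of "\<lambda>k. f k + g k" "P + R" n x]
    by (simp add: Aset_add agrees_add act_eq_pact[of f P n] act_eq_pact[of g R n] pact_add)
  have "act (\<lambda>k. f k * g k) x = pact P (pact R x)"
    using fg P R n(1) act_eq_pact[of "\<lambda>k. f k * g k" "P * R" n x]
    by (simp add: Aset_mult agrees_mult pact_mult)
  also have "pact R x = act g x" using fg R n by (simp add: act_eq_pact[of g R n])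
  also have "pact P (act g x) = act f (act g x)" using fg P n by (simp add: act_eq_pact[of f P n])
  finally show "act (\<lambda>k. f k * g k) x = act f (act g x)" .
next
  fix x
  obtain n where n: "pact (Theta_poly n) x = 0" using Theta_poly_kills by blast
  show "act (\<lambda>k. 1) x = x"
    using n Aset_poly[of 1] act_eq_pact[of "\<lambda>k. 1" 1 n x] by (simp add: agrees_def)
qed

lemma discrete_A_module_act: "discrete_A_module p q act"
  unfolding discrete_A_module_def
proof (intro conjI A_module_act allI)
  fix x
  obtain n where "pact (Theta_poly n) x = 0" using Theta_poly_kills by blast
  hence "act f x = 0" if "f \<in> Afilt p q n" for f
    using that act_eq_pact[of f 0 n x] by (auto simp: Afilt_iff agrees_def)
  thus "\<exists>n. \<forall>f\<in>Afilt p q n. act f x = 0" by blast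
qed

text \<open>Compare both sides with the operation of a power \<open>Q ^ s\<close> near
  \<open>j\<close>: condition (c) controls the given \<open>psi\<close>, and
  \<open>adams_diff\<close> the constructed action. The difference lies in every
  \<open>p^m R x\<close>, hence is \<open>0\<close> by Krull.\<close>

lemma act_adams:
  assumes j: "j \<in> zp_units p"
  shows "act (adams j) x = psi j x"
proof -
  obtain n where n: "pact (Theta_poly n) x = 0" using Theta_poly_kills by blast
  obtain C where C: "\<And>j j' m. j \<in> zp_units p \<Longrightarrow> j' \<in> zp_units p \<Longrightarrow>
     (j - j') / of_nat p ^ (C + m) \<in> zp p \<Longrightarrow>
     \<exists>H. zp_poly H \<and> agrees n (\<lambda>k. adams j k - adams j' k) (smult (of_nat p ^ m) H)"
    using adams_diff[where n = n] by blast
  obtain S where S: "finite S" "zspan p sc S = Rsub p sc psi x"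
    using Rsub_finitely_generated by blast
  have *: "\<exists>z\<in>Rsub p sc psi x. psi j x - act (adams j) x = sc (of_nat p ^ Suc m) z" for m
  proof -
    obtain k where k: "\<And>j j' y. j \<in> zp_units p \<Longrightarrow> j' \<in> zp_units p \<Longrightarrow>
      (j - j') / of_nat p ^ k \<in> zp p \<Longrightarrow> y \<in> Rsub p sc psi x \<Longrightarrow>
      \<exists>z\<in>Rsub p sc psi x. psi j y - psi j' y = sc (of_nat p ^ Suc m) z"
      using Rsub_adic_continuous[of "Suc m" x] by (metis le_add1 plus_1_eq_Suc)
    \<comment> \<open>A single \<open>s\<close> has to be close enough for both comparisons, which
      need precision \<open>k\<close> and \<open>C + Suc m\<close>.\<close>
    obtain s where s: "(j - Q ^ s) / of_nat p ^ (k + (C + Suc m)) \<in> zp p"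
      using zp_units_approx[OF j] .
    have s1: "(j - Q ^ s) / of_nat p ^ k \<in> zp p" and s2: "(j - Q ^ s) / of_nat p ^ (C + Suc m) \<in> zp p"
      by (rule zp_divide_power_mono[OF s], simp)+
    obtain z where z: "z \<in> Rsub p sc psi x" "psi j x - psi (Q ^ s) x = sc (of_nat p ^ Suc m) z"
      using k[OF j _ s1 self_in_Rsub] by auto
    obtain H where H: "zp_poly H"
      "agrees n (\<lambda>k. adams j k - adams (Q ^ s) k) (smult (of_nat p ^ Suc m) H)"
      using C[OF j _ s2] by auto
    have "agrees n (adams j) (smult (of_nat p ^ Suc m) H + monom 1 s)"
      using agrees_add[OF H(2) agrees_poly[of n "monom 1 s"]] by (simp add: adams_Q_power)
    hence "act (adams j) x = pact (smult (of_nat p ^ Suc m) H + monom 1 s) x"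
      using j n H(1) by (intro act_eq_pact zp_poly_add zp_poly_smult) auto
    also have "\<dots> = sc (of_nat p ^ Suc m) (pact H x) + psi (Q ^ s) x"
      using H(1) p_power_zp by (simp add: pact_add pact_smult pact_monom psi_power del: power_Suc)
    finally have "psi j x - act (adams j) x = sc (of_nat p ^ Suc m) (z - pact H x)"
      using z(2) p_power_zp by (simp add: sc_diff_right algebra_simps del: power_Suc)
    moreover have "z - pact H x \<in> Rsub p sc psi x"
      using z(1) pact_Rsub[OF H(1) self_in_Rsub] by (intro submod_diff submod_Rsub)
    ultimately show ?thesis by blast
  qed
  \<comment> \<open>Passing from \<open>Suc m\<close> to \<open>m\<close> includes
    \<open>m = 0\<close>, where (c) says nothing but the intersection lemma asks for a
    witness.\<close>
  have "\<exists>z\<in>Rsub p sc psi x. psi j x - act (adams j) x = sc (of_nat p ^ m) z" for m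
  proof -
    obtain z where "z \<in> Rsub p sc psi x" "psi j x - act (adams j) x = sc (of_nat p ^ m * of_nat p) z"
      using *[of m] by (auto simp: power_Suc2 simp del: power_Suc)
    thus ?thesis
      by (intro bexI[of _ "sc (of_nat p) z"]) (auto simp: sc_mult submod_sc[OF submod_Rsub])
  qed
  hence "psi j x - act (adams j) x = 0" using krull_intersection[OF S(1)] S(2) by metis
  thus ?thesis by simp
qed

lemma extends_R_act: "extends_R p sc psi act"
  unfolding extends_R_def
proof (intro conjI ballI ext)
  fix c x assume c: "c \<in> zp p"
  obtain n where "pact (Theta_poly n) x = 0" using Theta_poly_kills by blast
  thus "act (const_op c) x = sc c x"
    using c agrees_const act_eq_pact[of "const_op c" "[:c:]" n x] by simp
qed (rule act_adams)

end

theorem theorem4p6: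
  fixes p :: nat and q :: int
  assumes "prime p" and "odd p" and "primitive_mod (int (p ^ 2)) q"
  shows
    "(\<forall>act :: (int \<Rightarrow> rat) \<Rightarrow> 'm::ab_group_add \<Rightarrow> 'm.
        discrete_A_module p q act \<longrightarrow>
        bousfield_module p (\<lambda>c. act (const_op c)) (\<lambda>j. act (adams j)))
   \<and> (\<forall>(sc :: rat \<Rightarrow> 'm \<Rightarrow> 'm) psi. bousfield_module p sc psi \<longrightarrow>
        (\<exists>act. discrete_A_module p q act \<and> extends_R p sc psi act) \<and>
        (\<forall>act act'. discrete_A_module p q act \<and> extends_R p sc psi act \<and>
                    discrete_A_module p q act' \<and> extends_R p sc psi act' \<longrightarrow>
                    (\<forall>f\<in>Aset p q. act f = act' f)))
   \<and> (\<forall>(sc :: rat \<Rightarrow> 'm \<Rightarrow> 'm) psi (sc' :: rat \<Rightarrow> 'n::ab_group_add \<Rightarrow> 'n) psi' act act' h.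
        bousfield_module p sc psi \<and> bousfield_module p sc' psi' \<and>
        discrete_A_module p q act \<and> extends_R p sc psi act \<and>
        discrete_A_module p q act' \<and> extends_R p sc' psi' act' \<and>
        R_hom p sc psi sc' psi' h \<longrightarrow> A_hom p q act act' h)"
proof -
  interpret adams_base p q by unfold_locales fact+
  show ?thesis
  proof (intro conjI allI impI)
    fix act :: "(int \<Rightarrow> rat) \<Rightarrow> 'm \<Rightarrow> 'm" assume "discrete_A_module p q act"
    then interpret discrete_module p q act by unfold_locales
    show "bousfield_module p sc psi" by (rule bousfield_module_act)
  next
    fix sc :: "rat \<Rightarrow> 'm \<Rightarrow> 'm" and psi assume "bousfield_module p sc psi"
    then interpret bousfield p q sc psi by unfold_locales
    show "\<exists>act. discrete_A_module p q act \<and> extends_R p sc psi act"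
      using discrete_A_module_act extends_R_act by blast
  next
    fix sc :: "rat \<Rightarrow> 'm \<Rightarrow> 'm" and psi and act act' :: "(int \<Rightarrow> rat) \<Rightarrow> 'm \<Rightarrow> 'm"
    assume *: "discrete_A_module p q act \<and> extends_R p sc psi act \<and>
      discrete_A_module p q act' \<and> extends_R p sc psi act'"
    \<comment> \<open>Uniqueness of the extension is the morphism statement for the identity map
      between the two structures.\<close>
    have "R_hom p sc psi sc psi (\<lambda>x. x)" by (simp add: R_hom_def)
    with * have "A_hom p q act act' (\<lambda>x. x)" by (elim conjE) (rule R_hom_imp_A_hom)
    thus "\<forall>f\<in>Aset p q. act f = act' f" by (auto simp: A_hom_def)
  qed (elim conjE, rule R_hom_imp_A_hom)
qed

end
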